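(* Let $t=0$ be a generic inflection point of a regular $C^\infty$ curve $\gamma(t)$ in $\mathbb{R}^2$, and let $s_A$ be the affine arclength parameter. Then $\tau=\operatorname{sgn}(t)|s_A|^{3/4}$ can be taken to be a coordinate of $\gamma$ at $t=0$ (called the $3/4$-arclength parameter), and $f:=(s_A)^2\kappa_A$ is a $C^\infty$-function of $t$ (and of $\tau$) at $t=0$. Moreover, $f$ satisfies (dots denoting $d/dt$) $$-\frac97\left(\frac{[\dot\gamma(0),\gamma^{(4)}(0)]+[\ddot\gamma(0),\gamma^{(3)}(0)]}{[\dot\gamma(0),\gamma^{(3)}(0)]}\right)\dot f(0)+32\,\dot f(0)^2+9\,\ddot f(0)=0,$$ and $$\lim_{t\to0}(s_A)^2\kappa_A\;(=f(0))=-\frac5{16},\qquad \lim_{t\to0}\frac{(s_A)^2\kappa_A+5/16}{\tau}=-\frac{3\sqrt[4]{3}}{28\sqrt2}\,\mu_I,$$ where $\mu_I$ is the affine inflectional curvature at $t=0$. Furthermore, if $t=\tau$, then the first identity reduces to $$32\left(\frac{df}{d\tau}(0)\right)^2+9\,\frac{d^2f}{d\tau^2}(0)=0.\qquad( * )$$ Conversely, for any $C^\infty$-function $f(\tau)$ (defined near $\tau=0$) satisfying $f(0)=-5/16$ and $( * )$, there exists a regular curve in $\mathbb{R}^2$ with a generic inflection point at $\tau=0$ whose normalized affine curvature function $(s_A)^2\kappa_A$ is $f(\tau)$ with respect to the $3/4$-arclength parameter $\tau$.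
   Context: For $\mathbf a,\mathbf b\in\mathbb{R}^2$, $[\mathbf a,\mathbf b]=a_1b_2-a_2b_1$. A point $t=0$ of a regular curve $\gamma$ is an inflection point if $[\dot\gamma(0),\ddot\gamma(0)]=0$; it is generic if moreover $[\dot\gamma(0),\gamma^{(3)}(0)]\ne0$. The affine arclength is $s_A(t)=\int_0^t\bigl|[\dot\gamma(u),\ddot\gamma(u)]\bigr|^{1/3}du$, and the affine curvature (for $t\ne0$ near $0$) is $$\kappa_A=\frac{3[\dot\gamma,\ddot\gamma]\,[\dot\gamma,\gamma^{(4)}]+12[\dot\gamma,\ddot\gamma]\,[\ddot\gamma,\gamma^{(3)}]-5[\dot\gamma,\gamma^{(3)}]^2}{9\,\bigl|[\dot\gamma,\ddot\gamma]\bigr|^{8/3}}.$$ The affine inflectional curvature at a generic inflection point $t=0$ is $$\mu_I=\epsilon_I\,\frac{[\dot\gamma(0),\gamma^{(4)}(0)]-6[\ddot\gamma(0),\gamma^{(3)}(0)]}{\bigl|[\dot\gamma(0),\gamma^{(3)}(0)]\bigr|^{5/4}},\qquad \epsilon_I=\operatorname{sgn}[\dot\gamma(0),\gamma^{(3)}(0)].$$ Smoothness at $t=0$ concerns germs at $t=0$, functions being extended across $t=0$. *)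

theory Defs
  imports "HOL-Analysis.Analysis"
begin

definition bracket :: "real^2 \<Rightarrow> real^2 \<Rightarrow> real" where
  "bracket a b = a $ 1 * b $ 2 - a $ 2 * b $ 1"

text \<open>The same iterated derivative is used for plane curves and for real-valued functions.\<close>

definition nderiv :: "nat \<Rightarrow> (real \<Rightarrow> 'a::real_normed_vector) \<Rightarrow> real \<Rightarrow> 'a" where
  "nderiv n f = ((\<lambda>h t. vector_derivative h (at t)) ^^ n) f"

text \<open>Intended for open sets. All derivatives are then automatically continuous, being differentiable.\<close>

definition smooth_on :: "real set \<Rightarrow> (real \<Rightarrow> 'a::real_normed_vector) \<Rightarrow> bool" where
  "smooth_on S f \<longleftrightarrow> (\<forall>n. \<forall>t\<in>S. nderiv n f differentiable (at t))"

definition smooth_at :: "real \<Rightarrow> (real \<Rightarrow> 'a::real_normed_vector) \<Rightarrow> bool" where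
  "smooth_at t0 f \<longleftrightarrow> (\<exists>S. open S \<and> t0 \<in> S \<and> smooth_on S f)"

definition local_coordinate_at :: "real \<Rightarrow> (real \<Rightarrow> real) \<Rightarrow> bool" where
  "local_coordinate_at t0 \<phi> \<longleftrightarrow>
     (\<exists>U V \<psi>. open U \<and> open V \<and> t0 \<in> U \<and> homeomorphism U V \<phi> \<psi> \<and> smooth_on U \<phi> \<and> smooth_on V \<psi>)"

definition regular_curve :: "real set \<Rightarrow> (real \<Rightarrow> real^2) \<Rightarrow> bool" where
  "regular_curve I \<gamma> \<longleftrightarrow> open I \<and> is_interval I \<and> smooth_on I \<gamma> \<and> (\<forall>t\<in>I. nderiv 1 \<gamma> t \<noteq> 0)"

definition inflection_point :: "(real \<Rightarrow> real^2) \<Rightarrow> real \<Rightarrow> bool" where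
  "inflection_point \<gamma> t \<longleftrightarrow> bracket (nderiv 1 \<gamma> t) (nderiv 2 \<gamma> t) = 0"

definition generic_inflection_point :: "(real \<Rightarrow> real^2) \<Rightarrow> real \<Rightarrow> bool" where
  "generic_inflection_point \<gamma> t \<longleftrightarrow>
     inflection_point \<gamma> t \<and> bracket (nderiv 1 \<gamma> t) (nderiv 3 \<gamma> t) \<noteq> 0"

text \<open>The interval integral is oriented, so the arclength is negative for negative \<open>t\<close>.\<close>

definition affine_arclength :: "(real \<Rightarrow> real^2) \<Rightarrow> real \<Rightarrow> real" where
  "affine_arclength \<gamma> t =
     (LBINT u=0..t. \<bar>bracket (nderiv 1 \<gamma> u) (nderiv 2 \<gamma> u)\<bar> powr (1/3))"

definition affine_curvature :: "(real \<Rightarrow> real^2) \<Rightarrow> real \<Rightarrow> real" where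
  "affine_curvature \<gamma> t =
     (3 * bracket (nderiv 1 \<gamma> t) (nderiv 2 \<gamma> t) * bracket (nderiv 1 \<gamma> t) (nderiv 4 \<gamma> t)
      + 12 * bracket (nderiv 1 \<gamma> t) (nderiv 2 \<gamma> t) * bracket (nderiv 2 \<gamma> t) (nderiv 3 \<gamma> t)
      - 5 * (bracket (nderiv 1 \<gamma> t) (nderiv 3 \<gamma> t))\<^sup>2)
     / (9 * \<bar>bracket (nderiv 1 \<gamma> t) (nderiv 2 \<gamma> t)\<bar> powr (8/3))"

definition affine_inflectional_curvature :: "(real \<Rightarrow> real^2) \<Rightarrow> real \<Rightarrow> real" where
  "affine_inflectional_curvature \<gamma> t =
     sgn (bracket (nderiv 1 \<gamma> t) (nderiv 3 \<gamma> t))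
     * ((bracket (nderiv 1 \<gamma> t) (nderiv 4 \<gamma> t) - 6 * bracket (nderiv 2 \<gamma> t) (nderiv 3 \<gamma> t))
        / \<bar>bracket (nderiv 1 \<gamma> t) (nderiv 3 \<gamma> t)\<bar> powr (5/4))"

definition three_quarter_arclength :: "(real \<Rightarrow> real^2) \<Rightarrow> real \<Rightarrow> real" where
  "three_quarter_arclength \<gamma> t = sgn t * \<bar>affine_arclength \<gamma> t\<bar> powr (3/4)"

text \<open>
  The affine curvature is not defined at an inflection point (the formula above divides by \<open>0\<close>
  there); \<open>extend_at_0\<close> replaces the meaningless value at \<open>0\<close> by the limit at \<open>0\<close>.
\<close>

definition extend_at_0 :: "(real \<Rightarrow> real) \<Rightarrow> real \<Rightarrow> real" where
  "extend_at_0 g t = (if t = 0 then Lim (at 0) g else g t)"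

definition normalized_affine_curvature :: "(real \<Rightarrow> real^2) \<Rightarrow> real \<Rightarrow> real" where
  "normalized_affine_curvature \<gamma> =
     extend_at_0 (\<lambda>t. (affine_arclength \<gamma> t)\<^sup>2 * affine_curvature \<gamma> t)"

end

theory Submission
  imports Defs
begin

text \<open>
  Write \<open>W = [\<gamma>', \<gamma>'']\<close>, so that \<open>W' = [\<gamma>', \<gamma>''']\<close> and, by Hadamard's lemma, \<open>W(t) = t w(t)\<close>
  with \<open>w\<close> smooth and \<open>w(0) = W'(0) \<noteq> 0\<close>. Everything singular about the inflection point sits
  in the explicit factor \<open>t\<close>: substituting \<open>u = t v\<close> in the arclength integral gives
  \<open>s = t |t|^(1/3) \<sigma>(t)\<close> with \<open>\<sigma>(t)\<close> the integral of \<open>v^(1/3) |w(t v)|^(1/3)\<close> over \<open>0 \<le> v \<le> 1\<close>,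
  which is smooth and positive. Hence \<open>\<tau> = t \<sigma>(t)^(3/4)\<close> is a coordinate, and in \<open>s\<^sup>2 \<kappa>\<close> the powers
  of \<open>|t|\<close> cancel, leaving the smooth function \<open>F = \<sigma>\<^sup>2 N / (9 |w|^(8/3))\<close>, where \<open>N\<close> is the numerator of
  \<open>\<kappa>\<close>. The values \<open>F(0)\<close>, \<open>F'(0)\<close>, \<open>F''(0)\<close> follow by comparing second-order Taylor polynomials in
  \<open>9 |w|^(8/3) F = \<sigma>\<^sup>2 N\<close>. A priori they involve derivatives of \<open>\<gamma>\<close> up to order five; the identity
  among them uses the Pluecker relation of the brackets, which at a point with \<open>W = 0\<close> reads
  \<open>[\<gamma>', \<gamma>'''] [\<gamma>'', \<gamma>''''] = [\<gamma>', \<gamma>''''] [\<gamma>'', \<gamma>''']\<close>. The computation is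
  \<open>curvature_jet_algebra\<close>. Passing to the coordinate \<open>\<tau>\<close> only requires \<open>\<tau>''(0) / \<tau>'(0)\<close>, and the first-order
  term of the identity in \<open>t\<close> is exactly what this change of coordinate absorbs.

  For the converse, the parameter \<open>t\<close> is the 3/4-arclength as soon as \<open>W(t) = c t\<close> with \<open>c = 64/27\<close>, and
  then \<open>s\<^sup>2 \<kappa> = f\<close> amounts to \<open>[\<gamma>'', \<gamma>'''] = c p\<close> with \<open>t p = 16/9 (f + 5/16)\<close>. The velocity
  \<open>T = \<gamma>'\<close> must therefore solve \<open>t T'' - T' + p T = 0\<close>. Its exponents at the regular singular point \<open>0\<close> are
  \<open>0\<close> and \<open>2\<close>; their difference is an integer, so in general the solution of exponent \<open>0\<close> contains a
  logarithm. The coefficient of the logarithm is a multiple of \<open>p(0)\<^sup>2 + p'(0)\<close>, that is, of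
  \<open>32 f'(0)\<^sup>2 + 9 f''(0)\<close>, so the hypothesis says precisely that both components of \<open>T\<close> can be taken smooth.
  With \<open>y = t\<^sup>2 u\<close> and \<open>y' = t V\<close> the equation becomes the integral equation of
  \<open>continuous_integral_equation_solution\<close>, which is solved by contraction. This gives the component of \<open>T\<close>
  of exponent \<open>2\<close>; for the other one, \<open>y = 1 + p(0) t + t\<^sup>2 u\<close> leads to the same equation with an
  inhomogeneity that is smooth because of the hypothesis. The curve is assembled in
  \<open>curvature_function_realized\<close>.
\<close>

section \<open>Functions with finitely many derivatives\<close>

text \<open>
  Smoothness of order \<open>n\<close> by recursion on the derivative, which is only required to exist on \<open>S\<close> and may be
  chosen freely elsewhere. This makes closure properties provable by induction on \<open>n\<close>, which the
  iterated derivative of a fixed representative does not allow directly.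
\<close>

primrec ck_on :: "nat \<Rightarrow> real set \<Rightarrow> (real \<Rightarrow> 'a::real_normed_vector) \<Rightarrow> bool" where
  "ck_on 0 S f \<longleftrightarrow> continuous_on S f"
| "ck_on (Suc n) S f \<longleftrightarrow>
     (\<exists>f'. (\<forall>t\<in>S. (f has_vector_derivative f' t) (at t)) \<and> ck_on n S f')"

lemma ck_on_SucI:
  "(\<And>t. t \<in> S \<Longrightarrow> (f has_vector_derivative f' t) (at t)) \<Longrightarrow> ck_on n S f' \<Longrightarrow> ck_on (Suc n) S f"
  by auto

lemma ck_on_SucE:
  assumes "ck_on (Suc n) S f"
  obtains f' where "\<forall>t\<in>S. (f has_vector_derivative f' t) (at t)" "ck_on n S f'"
  using assms by auto

declare ck_on.simps(2) [simp del]

lemma ck_on_imp_continuous_on: "ck_on n S f \<Longrightarrow> continuous_on S f"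
  by (cases n)
    (auto intro!: continuous_at_imp_continuous_on elim!: ck_on_SucE dest: has_vector_derivative_continuous)

lemma ck_on_SucD: "ck_on (Suc n) S f \<Longrightarrow> ck_on n S f"
proof (induction n arbitrary: f)
  case 0
  then show ?case using ck_on_imp_continuous_on[of "Suc 0"] by simp
next
  case (Suc n)
  obtain f' where f': "\<forall>t\<in>S. (f has_vector_derivative f' t) (at t)" "ck_on (Suc n) S f'"
    by (rule ck_on_SucE[OF Suc.prems])
  show ?case
    by (rule ck_on_SucI[OF f'(1)[rule_format] Suc.IH[OF f'(2)]])
qed

lemma has_vector_derivative_cong_open:
  assumes "open S" "t \<in> S" "\<And>s. s \<in> S \<Longrightarrow> f s = g s"
  shows "(f has_vector_derivative D) (at t) \<longleftrightarrow> (g has_vector_derivative D) (at t)"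
  using assms has_vector_derivative_transform_within_open[of _ D t S] by metis

lemma ck_on_cong:
  assumes "open S" "\<And>t. t \<in> S \<Longrightarrow> f t = g t" "ck_on n S f"
  shows "ck_on n S g"
proof (cases n)
  case 0
  then show ?thesis using assms by (metis ck_on.simps(1) continuous_on_cong)
next
  case (Suc m)
  obtain f' where f': "\<forall>t\<in>S. (f has_vector_derivative f' t) (at t)" "ck_on m S f'"
    by (rule ck_on_SucE[OF assms(3)[unfolded Suc]])
  have "(g has_vector_derivative f' t) (at t)" if "t \<in> S" for t
    using f'(1)[rule_format, OF that] has_vector_derivative_cong_open[OF assms(1) that, of f g, OF assms(2)]
    by simp
  then show ?thesis unfolding Suc by (rule ck_on_SucI[OF _ f'(2)])
qed

lemma nderiv_0: "nderiv 0 f = f"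
  by (simp add: nderiv_def)

lemma nderiv_Suc: "nderiv (Suc n) f t = vector_derivative (nderiv n f) (at t)"
  by (simp add: nderiv_def)

lemma nderiv_Suc_shift: "nderiv (Suc n) f = nderiv n (\<lambda>t. vector_derivative f (at t))"
  by (simp add: nderiv_def funpow_Suc_right del: funpow.simps)

lemma nderiv_cong_open:
  assumes "open S" "\<And>s. s \<in> S \<Longrightarrow> f s = g s" "t \<in> S"
  shows "nderiv n f t = nderiv n g t"
  using assms(2,3)
proof (induction n arbitrary: t)
  case 0
  then show ?case by (simp add: nderiv_0)
next
  case (Suc n)
  have "(nderiv n f has_vector_derivative D) (at t) \<longleftrightarrow> (nderiv n g has_vector_derivative D) (at t)" for D
    using has_vector_derivative_cong_open[OF assms(1), of t "nderiv n f" "nderiv n g"] Suc by blast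
  then show ?case
    by (simp add: nderiv_Suc vector_derivative_def)
qed

lemma nderiv_Suc_eq:
  assumes "open S" "\<And>s. s \<in> S \<Longrightarrow> (f has_vector_derivative f' s) (at s)" "t \<in> S"
  shows "nderiv (Suc n) f t = nderiv n f' t"
  unfolding nderiv_Suc_shift
  by (rule nderiv_cong_open[OF assms(1) _ assms(3)]) (simp add: assms(2) vector_derivative_at)

lemma ck_on_Suc_nderiv_differentiable:
  assumes "open S" "ck_on (Suc n) S f" "t \<in> S"
  shows "nderiv n f differentiable (at t)"
  using assms(2,3)
proof (induction n arbitrary: f t)
  case 0
  then show ?case
    by (auto simp: nderiv_0 elim!: ck_on_SucE intro: differentiableI_vector)
next
  case (Suc n)
  obtain f' where f': "\<forall>s\<in>S. (f has_vector_derivative f' s) (at s)" "ck_on (Suc n) S f'"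
    by (rule ck_on_SucE[OF Suc.prems(1)])
  have "nderiv n f' differentiable (at t)"
    using Suc.IH f'(2) Suc.prems(2) by blast
  then obtain D where "(nderiv n f' has_vector_derivative D) (at t)"
    using vector_derivative_works by blast
  then have "(nderiv (Suc n) f has_vector_derivative D) (at t)"
    using has_vector_derivative_cong_open[OF assms(1) Suc.prems(2), of "nderiv (Suc n) f" "nderiv n f'"]
      nderiv_Suc_eq[OF assms(1) f'(1)[rule_format]] by blast
  then show ?case by (rule differentiableI_vector)
qed

lemma smooth_on_has_nderiv:
  assumes "smooth_on S f" "t \<in> S"
  shows "(nderiv n f has_vector_derivative nderiv (Suc n) f t) (at t)"
  using assms by (simp add: smooth_on_def nderiv_Suc vector_derivative_works)

lemma smooth_on_imp_ck_on_nderiv: "smooth_on S f \<Longrightarrow> ck_on n S (nderiv m f)"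
proof (induction n arbitrary: m)
  case 0
  then show ?case
    using smooth_on_has_nderiv[of S f _ m]
    by (auto intro!: continuous_at_imp_continuous_on dest: has_vector_derivative_continuous)
next
  case (Suc n)
  show ?case
    by (rule ck_on_SucI[OF smooth_on_has_nderiv[OF Suc.prems] Suc.IH[OF Suc.prems]])
qed

text \<open>
  The bridge that transfers every closure property of \<open>ck_on\<close> to \<open>smooth_on\<close>.
\<close>

lemma smooth_on_iff_ck_on:
  assumes "open S"
  shows "smooth_on S f \<longleftrightarrow> (\<forall>n. ck_on n S f)"
proof
  show "\<forall>n. ck_on n S f" if "smooth_on S f"
    using smooth_on_imp_ck_on_nderiv[OF that, of _ 0] by (simp add: nderiv_0)
  show "smooth_on S f" if "\<forall>n. ck_on n S f"
    unfolding smooth_on_def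
  proof (intro allI ballI)
    fix n t assume "t \<in> S"
    then show "nderiv n f differentiable (at t)"
      using ck_on_Suc_nderiv_differentiable[OF assms, of n f t] that by simp
  qed
qed

lemma smooth_on_nderiv: "open S \<Longrightarrow> smooth_on S f \<Longrightarrow> smooth_on S (nderiv m f)"
  using smooth_on_imp_ck_on_nderiv smooth_on_iff_ck_on by blast

lemma smooth_on_subset: "smooth_on S f \<Longrightarrow> T \<subseteq> S \<Longrightarrow> smooth_on T f"
  by (auto simp: smooth_on_def)

lemma smooth_on_cong:
  assumes "open S" "\<And>t. t \<in> S \<Longrightarrow> f t = g t" "smooth_on S f"
  shows "smooth_on S g"
  using assms ck_on_cong smooth_on_iff_ck_on by metis

lemma smooth_on_imp_continuous_on: "smooth_on S f \<Longrightarrow> continuous_on S f"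
  using smooth_on_imp_ck_on_nderiv[of S f 0 0] by (simp add: nderiv_0)

lemma ck_on_const: "ck_on n S (\<lambda>t. c)"
  by (induction n arbitrary: c) (auto intro: ck_on_SucI[where f'="\<lambda>_. 0"])

lemma ck_on_ident: "ck_on n S (\<lambda>t. t)"
  by (cases n) (auto intro: ck_on_SucI[where f'="\<lambda>_. 1"] ck_on_const)

lemma ck_on_add: "ck_on n S f \<Longrightarrow> ck_on n S g \<Longrightarrow> ck_on n S (\<lambda>t. f t + g t)"
proof (induction n arbitrary: f g)
  case 0
  then show ?case by (simp add: continuous_on_add)
next
  case (Suc n)
  obtain f' where f': "\<forall>s\<in>S. (f has_vector_derivative f' s) (at s)" "ck_on n S f'"
    by (rule ck_on_SucE[OF Suc.prems(1)])
  obtain g' where g': "\<forall>s\<in>S. (g has_vector_derivative g' s) (at s)" "ck_on n S g'"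
    by (rule ck_on_SucE[OF Suc.prems(2)])
  show ?case
    by (rule ck_on_SucI[OF has_vector_derivative_add[OF f'(1)[rule_format] g'(1)[rule_format]] Suc.IH[OF f'(2) g'(2)]])
qed

lemma ck_on_bilinear:
  assumes "bounded_bilinear B"
  shows "ck_on n S f \<Longrightarrow> ck_on n S g \<Longrightarrow> ck_on n S (\<lambda>t. B (f t) (g t))"
proof (induction n arbitrary: f g)
  case 0
  then show ?case by (simp add: bounded_bilinear.continuous_on[OF assms])
next
  case (Suc n)
  obtain f' where f': "\<forall>s\<in>S. (f has_vector_derivative f' s) (at s)" "ck_on n S f'"
    by (rule ck_on_SucE[OF Suc.prems(1)])
  obtain g' where g': "\<forall>s\<in>S. (g has_vector_derivative g' s) (at s)" "ck_on n S g'"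
    by (rule ck_on_SucE[OF Suc.prems(2)])
  have "ck_on n S (\<lambda>t. B (f t) (g' t) + B (f' t) (g t))"
    by (intro ck_on_add Suc.IH f'(2) g'(2) Suc.prems[THEN ck_on_SucD])
  moreover have "((\<lambda>t. B (f t) (g t)) has_vector_derivative B (f t) (g' t) + B (f' t) (g t)) (at t)"
    if "t \<in> S" for t
    using bounded_bilinear.has_vector_derivative[OF assms f'(1)[rule_format, OF that] g'(1)[rule_format, OF that]] .
  ultimately show ?case by (rule ck_on_SucI[rotated])
qed

lemmas ck_on_mult = ck_on_bilinear[OF bounded_bilinear_mult]
lemmas ck_on_scaleR = ck_on_bilinear[OF bounded_bilinear_scaleR]

lemma ck_on_compose:
  fixes f :: "real \<Rightarrow> real" and g :: "real \<Rightarrow> 'a::real_normed_vector"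
  assumes "f ` S \<subseteq> T"
  shows "ck_on n T g \<Longrightarrow> ck_on n S f \<Longrightarrow> ck_on n S (\<lambda>t. g (f t))"
proof (induction n arbitrary: g)
  case 0
  then show ?case using assms continuous_on_compose2 by auto
next
  case (Suc n)
  obtain f' where f': "\<forall>s\<in>S. (f has_vector_derivative f' s) (at s)" "ck_on n S f'"
    by (rule ck_on_SucE[OF Suc.prems(2)])
  obtain g' where g': "\<forall>s\<in>T. (g has_vector_derivative g' s) (at s)" "ck_on n T g'"
    by (rule ck_on_SucE[OF Suc.prems(1)])
  have "ck_on n S (\<lambda>t. f' t *\<^sub>R g' (f t))"
    by (intro ck_on_scaleR Suc.IH f'(2) g'(2) Suc.prems[THEN ck_on_SucD])
  moreover have "((\<lambda>t. g (f t)) has_vector_derivative f' s *\<^sub>R g' (f s)) (at s)" if "s \<in> S" for s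
    using vector_diff_chain_at[OF f'(1)[rule_format, OF that] g'(1)[rule_format, of "f s"]] that assms
    by (auto simp: o_def)
  ultimately show ?case by (rule ck_on_SucI[rotated])
qed

text \<open>
  The exponent has to be arbitrary, as differentiation lowers it.
\<close>

lemma ck_on_powr: "ck_on n {0<..} (\<lambda>x::real. x powr a)"
proof (induction n arbitrary: a)
  case 0
  then show ?case by (auto intro!: continuous_intros)
next
  case (Suc n)
  have "ck_on n {0<..} (\<lambda>x. a * x powr (a - 1))"
    using ck_on_mult[OF ck_on_const Suc] .
  then show ?case
    by (auto intro!: ck_on_SucI[where f'="\<lambda>x. a * x powr (a - 1)"] has_real_derivative_powr
        simp: has_real_derivative_iff_has_vector_derivative[symmetric])
qed

lemma smooth_on_const: "open S \<Longrightarrow> smooth_on S (\<lambda>t. c)"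
  and smooth_on_ident: "open S \<Longrightarrow> smooth_on S (\<lambda>t. t)"
  and smooth_on_add: "open S \<Longrightarrow> smooth_on S f \<Longrightarrow> smooth_on S g \<Longrightarrow> smooth_on S (\<lambda>t. f t + g t)"
  by (simp_all add: smooth_on_iff_ck_on ck_on_const ck_on_ident ck_on_add)

lemma smooth_on_bilinear:
  "bounded_bilinear B \<Longrightarrow> open S \<Longrightarrow> smooth_on S f \<Longrightarrow> smooth_on S g
    \<Longrightarrow> smooth_on S (\<lambda>t. B (f t) (g t))"
  by (simp add: smooth_on_iff_ck_on ck_on_bilinear)

lemmas smooth_on_mult = smooth_on_bilinear[OF bounded_bilinear_mult]
lemmas smooth_on_scaleR = smooth_on_bilinear[OF bounded_bilinear_scaleR]

lemma smooth_on_power: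
  fixes f :: "real \<Rightarrow> real"
  assumes "open S" "smooth_on S f"
  shows "smooth_on S (\<lambda>t. f t ^ k)"
  by (induction k) (simp_all add: assms smooth_on_const smooth_on_mult)

lemma smooth_on_compose:
  fixes f :: "real \<Rightarrow> real"
  assumes "open S" "open T" "f ` S \<subseteq> T" "smooth_on T g" "smooth_on S f"
  shows "smooth_on S (\<lambda>t. g (f t))"
  using assms by (simp add: smooth_on_iff_ck_on ck_on_compose)

lemma ck_on_powr_compose:
  fixes f :: "real \<Rightarrow> real"
  assumes "ck_on n S f" "\<And>t. t \<in> S \<Longrightarrow> 0 < f t"
  shows "ck_on n S (\<lambda>t. f t powr a)"
  by (rule ck_on_compose[OF _ ck_on_powr[of n a] assms(1)]) (use assms(2) in auto)

lemma smooth_on_powr: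
  fixes f :: "real \<Rightarrow> real"
  assumes "open S" "smooth_on S f" "\<And>t. t \<in> S \<Longrightarrow> 0 < f t"
  shows "smooth_on S (\<lambda>t. f t powr a)"
  using assms by (simp add: smooth_on_iff_ck_on ck_on_powr_compose)

lemma smooth_on_divide:
  fixes f g :: "real \<Rightarrow> real"
  assumes "open S" "smooth_on S f" "smooth_on S g" "\<And>t. t \<in> S \<Longrightarrow> 0 < g t"
  shows "smooth_on S (\<lambda>t. f t / g t)"
proof (rule smooth_on_cong[OF assms(1)])
  show "smooth_on S (\<lambda>t. f t * g t powr (-1))"
    by (intro smooth_on_mult smooth_on_powr assms)
  show "f t * g t powr (-1) = f t / g t" if "t \<in> S" for t
    using assms(4)[OF that] by (simp add: powr_minus divide_inverse)
qed

text \<open>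
  On an interval a positive derivative makes \<open>f\<close> strictly increasing, hence a homeomorphism onto an open
  set. The inverse \<open>g\<close> satisfies \<open>g' = 1 / f'(g)\<close>, which gains one order of differentiability at each
  round.
\<close>

lemma smooth_inverse:
  fixes f :: "real \<Rightarrow> real"
  assumes S: "open S" "convex S" and f: "smooth_on S f" and pos: "\<And>t. t \<in> S \<Longrightarrow> 0 < nderiv 1 f t"
  obtains g where "homeomorphism S (f ` S) f g" "open (f ` S)" "smooth_on (f ` S) g"
proof -
  have der: "(f has_real_derivative nderiv 1 f t) (at t)" if "t \<in> S" for t
    using smooth_on_has_nderiv[OF f that, of 0]
    by (simp add: nderiv_0 has_real_derivative_iff_has_vector_derivative)
  have less: "f x < f y" if "x \<in> S" "y \<in> S" "x < y" for x y
  proof (rule DERIV_pos_imp_increasing[OF that(3)])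
    fix z assume "x \<le> z" "z \<le> y"
    then have "z \<in> S"
      using S(2) that by (meson is_interval_1 is_interval_convex_1)
    then show "\<exists>d. (f has_real_derivative d) (at z) \<and> 0 < d"
      using der pos by blast
  qed
  then have inj: "inj_on f S"
    by (metis inj_onI less_irrefl linorder_neqE_linordered_idom)
  obtain g where g: "homeomorphism S (f ` S) f g"
    using invariance_of_domain_homeomorphism[OF S(1) smooth_on_imp_continuous_on[OF f] _ inj] by auto
  have op: "open (f ` S)"
    using invariance_of_domain[OF smooth_on_imp_continuous_on[OF f] S(1) inj] .
  have gS: "g ` (f ` S) \<subseteq> S" and gf: "\<And>y. y \<in> f ` S \<Longrightarrow> f (g y) = y"
    and cg: "continuous_on (f ` S) g"
    using g by (auto simp: homeomorphism_def)
  have derg: "(g has_real_derivative inverse (nderiv 1 f (g y))) (at y)" if "y \<in> f ` S" for y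
  proof (rule has_field_derivative_inverse_basic[where f=f and t="f ` S"])
    show "(f has_real_derivative nderiv 1 f (g y)) (at (g y))"
      using der gS that by blast
    show "nderiv 1 f (g y) \<noteq> 0"
      using pos gS that by force
    show "continuous (at y) g"
      using cg op that continuous_on_eq_continuous_at by blast
  qed (use op that gf in auto)
  have "ck_on n (f ` S) g" for n
  proof (induction n)
    case 0
    then show ?case using cg by simp
  next
    case (Suc n)
    have "ck_on n (f ` S) (\<lambda>y. nderiv 1 f (g y))"
      by (rule ck_on_compose[OF gS smooth_on_imp_ck_on_nderiv[OF f] Suc])
    then have "ck_on n (f ` S) (\<lambda>y. nderiv 1 f (g y) powr (-1))"
      by (rule ck_on_powr_compose) (use pos gS in blast)
    moreover have eq: "nderiv 1 f (g y) powr (-1) = inverse (nderiv 1 f (g y))" if "y \<in> f ` S" for y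
    proof -
      have "0 < nderiv 1 f (g y)"
        using pos gS that by blast
      then show ?thesis by (simp add: powr_minus)
    qed
    ultimately have "ck_on n (f ` S) (\<lambda>y. inverse (nderiv 1 f (g y)))"
      by (intro ck_on_cong[OF op eq])
    then show ?case
      using derg by (auto intro!: ck_on_SucI simp: has_real_derivative_iff_has_vector_derivative[symmetric])
  qed
  then show thesis using that g op smooth_on_iff_ck_on by blast
qed

section \<open>Weighted means over dilations\<close>

text \<open>
  For \<open>\<phi> = 1\<close> this is the remainder factor of Hadamard's lemma when \<open>h\<close> is a derivative, and \<open>t\<close> times it is
  the integral of \<open>h\<close> from \<open>0\<close> to \<open>t\<close>; the weights \<open>v^(1/3)\<close> and \<open>v\<close> give the factors that are left when
  powers of \<open>t\<close> are split off from the arclength integral and from a double integral. The integration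
  domain does not depend on \<open>t\<close>, so such factors inherit smoothness at \<open>t = 0\<close>.
\<close>

definition dilation_mean :: "(real \<Rightarrow> real) \<Rightarrow> (real \<Rightarrow> real) \<Rightarrow> real \<Rightarrow> real" where
  "dilation_mean \<phi> h t = integral {0..1} (\<lambda>v. \<phi> v * h (t * v))"

lemma scaled_mem_symmetric_interval:
  fixes d t v :: real
  assumes "t \<in> {-d<..<d}" "v \<in> {0..1}"
  shows "t * v \<in> {-d<..<d}"
proof -
  have "\<bar>t * v\<bar> \<le> \<bar>t\<bar>"
    using assms(2) by (simp add: abs_mult mult_left_le)
  then show ?thesis using assms(1) by (auto simp: abs_less_iff abs_le_iff)
qed

lemma continuous_on_dilation_integrand:
  assumes "continuous_on {0..1} \<phi>" "continuous_on {-d<..<d} h"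
  shows "continuous_on ({-d<..<d} \<times> cbox 0 1) (\<lambda>(t, v). \<phi> v * h (t * v :: real) :: real)"
  unfolding split_def
  using scaled_mem_symmetric_interval
  by (intro continuous_intros continuous_on_compose2[OF assms(1)] continuous_on_compose2[OF assms(2)]) auto

lemma dilation_mean_integrable:
  assumes "continuous_on {0..1} \<phi>" "continuous_on {-d<..<d} h" "t \<in> {-d<..<d}"
  shows "(\<lambda>v. \<phi> v * h (t * v :: real) :: real) integrable_on {0..1}"
  by (intro integrable_continuous_interval continuous_intros assms(1) continuous_on_compose2[OF assms(2)])
    (use assms(3) scaled_mem_symmetric_interval in auto)

lemma continuous_on_dilation_mean:
  assumes "continuous_on {0..1} \<phi>" "continuous_on {-d<..<d} h"
  shows "continuous_on {-d<..<d} (dilation_mean \<phi> h)"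
  using integral_continuous_on_param[OF continuous_on_dilation_integrand[OF assms]]
  by (simp add: dilation_mean_def[abs_def])

text \<open>
  Differentiation under the integral sign multiplies the weight by \<open>v\<close>. Keeping the weight general
  makes the statement ready for iteration.
\<close>

lemma dilation_mean_has_derivative:
  assumes \<phi>: "continuous_on {0..1} \<phi>" and h': "continuous_on {-d<..<d} h'"
    and h: "\<And>t. t \<in> {-d<..<d} \<Longrightarrow> (h has_real_derivative h' t) (at t)"
    and t: "t \<in> {-d<..<d}"
  shows "(dilation_mean \<phi> h has_real_derivative dilation_mean (\<lambda>v. v * \<phi> v) h' t) (at t)"
proof -
  have "continuous_on {-d<..<d} h"
    using h by (meson DERIV_isCont continuous_at_imp_continuous_on)
  have "((\<lambda>t. integral (cbox 0 1) (\<lambda>v. \<phi> v * h (t * v))) has_real_derivative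
      integral (cbox 0 1) (\<lambda>v. v * \<phi> v * h' (t * v))) (at t within {-d<..<d})"
  proof (rule leibniz_rule_field_derivative)
    show "((\<lambda>t. \<phi> v * h (t * v)) has_real_derivative v * \<phi> v * h' (t * v)) (at t within {-d<..<d})"
      if "t \<in> {-d<..<d}" "v \<in> cbox 0 1" for t v
      using that h[OF scaled_mem_symmetric_interval[of t d v]]
      by (auto intro!: derivative_eq_intros DERIV_chain2[where f=h] simp: has_field_derivative_at_within)
    show "(\<lambda>v. \<phi> v * h (t * v)) integrable_on cbox 0 1" if "t \<in> {-d<..<d}" for t
      using dilation_mean_integrable[OF \<phi> \<open>continuous_on {-d<..<d} h\<close> that] by simp
    show "continuous_on ({-d<..<d} \<times> cbox 0 1) (\<lambda>(t, v). v * \<phi> v * h' (t * v))"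
      by (intro continuous_on_dilation_integrand continuous_intros \<phi> h')
  qed (use t in auto)
  then show ?thesis
    using t by (simp add: dilation_mean_def[abs_def] at_within_open[of t "{-d<..<d}"])
qed

lemma ck_on_dilation_mean:
  assumes "continuous_on {0..1} \<phi>" "ck_on n {-d<..<d} h"
  shows "ck_on n {-d<..<d} (dilation_mean \<phi> h)"
  using assms
proof (induction n arbitrary: \<phi> h)
  case 0
  then show ?case by (simp add: continuous_on_dilation_mean)
next
  case (Suc n)
  obtain h' where h': "\<forall>t\<in>{-d<..<d}. (h has_vector_derivative h' t) (at t)" "ck_on n {-d<..<d} h'"
    by (rule ck_on_SucE[OF Suc.prems(2)])
  have "(dilation_mean \<phi> h has_vector_derivative dilation_mean (\<lambda>v. v * \<phi> v) h' t) (at t)"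
    if "t \<in> {-d<..<d}" for t
    using dilation_mean_has_derivative[OF Suc.prems(1) ck_on_imp_continuous_on[OF h'(2)], of h t] h'(1) that
    by (simp add: has_real_derivative_iff_has_vector_derivative)
  moreover have "ck_on n {-d<..<d} (dilation_mean (\<lambda>v. v * \<phi> v) h')"
    by (intro Suc.IH continuous_intros Suc.prems h')
  ultimately show ?case by (rule ck_on_SucI)
qed

lemma smooth_on_dilation_mean:
  "continuous_on {0..1} \<phi> \<Longrightarrow> smooth_on {-d<..<d} h \<Longrightarrow> smooth_on {-d<..<d} (dilation_mean \<phi> h)"
  by (simp add: smooth_on_iff_ck_on ck_on_dilation_mean)

lemma dilation_mean_0: "dilation_mean \<phi> h 0 = integral {0..1} \<phi> * h 0"
  by (simp add: dilation_mean_def)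

text \<open>
  The fundamental theorem of calculus for \<open>v \<mapsto> H (t v)\<close> on the unit interval. It covers both signs of \<open>t\<close> at
  once, without oriented integrals.
\<close>

lemma dilation_mean_antiderivative:
  assumes "\<And>s. s \<in> {-d<..<d} \<Longrightarrow> (H has_real_derivative h s) (at s)" "t \<in> {-d<..<d}"
  shows "t * dilation_mean (\<lambda>_. 1) h t = H t - H 0"
proof -
  have "((\<lambda>v. H (t * v)) has_vector_derivative t * h (t * v)) (at v within {0..1})" if "v \<in> {0..1}" for v
    unfolding has_real_derivative_iff_has_vector_derivative[symmetric]
    by (rule DERIV_chain2[of H "h (t * v)" "\<lambda>v. t * v" v t, THEN DERIV_cong])
      (use assms(1)[OF scaled_mem_symmetric_interval[OF assms(2) that]] in
        \<open>auto intro!: derivative_eq_intros\<close>)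
  then have "((\<lambda>v. t * h (t * v)) has_integral H (t * 1) - H (t * 0)) {0..1}"
    by (intro fundamental_theorem_of_calculus) auto
  then show ?thesis
    by (simp add: dilation_mean_def integral_unique flip: integral_mult_right)
qed

lemma continuous_imp_antiderivative:
  fixes h :: "real \<Rightarrow> real"
  assumes "continuous_on {-d<..<d} h"
  shows "\<exists>H. \<forall>s\<in>{-d<..<d}. (H has_real_derivative h s) (at s)"
proof (cases "0 < d")
  case True
  have "\<exists>F. \<forall>x. ereal (-d) < ereal x \<longrightarrow> ereal x < ereal d \<longrightarrow> (F has_vector_derivative h x) (at x)"
    using assms continuous_on_eq_continuous_at[of "{-d<..<d}" h] True
    by (intro einterval_antiderivative) auto
  then obtain H where "\<forall>x. - d < x \<longrightarrow> x < d \<longrightarrow> (H has_vector_derivative h x) (at x)"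
    by auto
  then show ?thesis
    by (intro exI[of _ H]) (simp add: has_real_derivative_iff_has_vector_derivative)
qed auto

lemma has_derivative_antiderivative:
  assumes "continuous_on {-d<..<d} h" "t \<in> {-d<..<d}"
  shows "((\<lambda>t. t * dilation_mean (\<lambda>_. 1) h t) has_real_derivative h t) (at t)"
proof -
  obtain H where H: "\<And>s. s \<in> {-d<..<d} \<Longrightarrow> (H has_real_derivative h s) (at s)"
    using continuous_imp_antiderivative[OF assms(1)] by metis
  have "((\<lambda>t. H t - H 0) has_real_derivative h t) (at t)"
    using H[OF assms(2)] by (auto intro!: derivative_eq_intros)
  then show ?thesis
    by (rule DERIV_cong_ev[THEN iffD1, OF refl _ refl, rotated])
      (use dilation_mean_antiderivative[OF H] assms(2) in
        \<open>auto intro!: eventually_mono[OF eventually_nhds_in_open[of "{-d<..<d}" t]]\<close>)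
qed

text \<open>
  Connects the oriented integral in the definition of the affine arclength with dilation means: both are
  differences of the same antiderivative.
\<close>

lemma interval_integral_eq_dilation_mean:
  assumes "continuous_on {-d<..<d} h" "t \<in> {-d<..<d}"
  shows "(LBINT u=0..t. h u) = t * dilation_mean (\<lambda>_. 1) h t"
proof -
  obtain H where H: "\<And>s. s \<in> {-d<..<d} \<Longrightarrow> (H has_real_derivative h s) (at s)"
    using continuous_imp_antiderivative[OF assms(1)] by metis
  have sub: "{min 0 t..max 0 t} \<subseteq> {-d<..<d}"
    using assms(2) by auto
  have "(LBINT u=ereal 0..t. h u) = H t - H 0"
  proof (rule interval_integral_FTC_finite)
    show "continuous_on {min 0 t..max 0 t} h"
      using assms(1) sub by (rule continuous_on_subset)
    show "(H has_vector_derivative h x) (at x within {min 0 t..max 0 t})"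
      if "min 0 t \<le> x" "x \<le> max 0 t" for x
      using H[of x] that sub
      by (auto simp: has_real_derivative_iff_has_vector_derivative has_vector_derivative_at_within)
  qed
  then show ?thesis
    using dilation_mean_antiderivative[OF H assms(2)] by (simp add: zero_ereal_def)
qed

lemma hadamard_factor:
  assumes "smooth_on {-d<..<d} h" "t \<in> {-d<..<d}"
  shows "t * dilation_mean (\<lambda>_. 1) (nderiv 1 h) t = h t - h 0"
  using smooth_on_has_nderiv[OF assms(1), of _ 0] assms(2)
  by (intro dilation_mean_antiderivative)
    (auto simp: nderiv_0 has_real_derivative_iff_has_vector_derivative)

lemma dilation_mean_pos:
  assumes \<phi>: "continuous_on {0..1} \<phi>" "\<And>v. v \<in> {0<..<1} \<Longrightarrow> 0 < \<phi> v"
    and h: "continuous_on {-d<..<d} h" "\<And>t. t \<in> {-d<..<d} \<Longrightarrow> 0 < h t" and t: "t \<in> {-d<..<d}"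
  shows "0 < dilation_mean \<phi> h t"
proof -
  have "integral {0..1} (\<lambda>v::real. 0) < integral {0..1} (\<lambda>v. \<phi> v * h (t * v))"
  proof (rule integral_less_real)
    show "continuous_on {0..1} (\<lambda>v. \<phi> v * h (t * v))"
      by (intro continuous_intros \<phi> continuous_on_compose2[OF h(1)])
        (use t scaled_mem_symmetric_interval in auto)
    show "0 < \<phi> v * h (t * v)" if "v \<in> {0<..<1}" for v
      using that \<phi>(2) h(2)[OF scaled_mem_symmetric_interval[OF t, of v]] by auto
  qed auto
  then show ?thesis by (simp add: dilation_mean_def)
qed

section \<open>Second-order jets at the origin\<close>

text \<open>
  The numbers are the value, the first and the second derivative at \<open>0\<close>, not Taylor
  coefficients: there is no factor one half.
\<close>

definition has_2jet :: "(real \<Rightarrow> real) \<Rightarrow> real \<Rightarrow> real \<Rightarrow> real \<Rightarrow> bool" where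
  "has_2jet f a b c \<longleftrightarrow> f 0 = a \<and>
     (\<exists>f'. (\<forall>\<^sub>F t in nhds 0. (f has_real_derivative f' t) (at t)) \<and> f' 0 = b \<and>
           (f' has_real_derivative c) (at 0))"

lemma has_2jetI:
  assumes "\<forall>\<^sub>F t in nhds 0. (f has_real_derivative f' t) (at t)" "(f' has_real_derivative c) (at 0)"
  shows "has_2jet f (f 0) (f' 0) c"
  using assms by (auto simp: has_2jet_def)

lemma has_2jetE:
  assumes "has_2jet f a b c"
  obtains f' where "\<forall>\<^sub>F t in nhds 0. (f has_real_derivative f' t) (at t)"
    "(f has_real_derivative b) (at 0)" "(f' has_real_derivative c) (at 0)" "f 0 = a" "f' 0 = b"
proof -
  obtain f' where f': "\<forall>\<^sub>F t in nhds 0. (f has_real_derivative f' t) (at t)" "f 0 = a" "f' 0 = b"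
    "(f' has_real_derivative c) (at 0)"
    using assms unfolding has_2jet_def by auto
  then show thesis
    using that[of f'] eventually_nhds_x_imp_x[OF f'(1)] by simp
qed

lemma has_2jet_value: "has_2jet f a b c \<Longrightarrow> f 0 = a"
  by (simp add: has_2jet_def)

lemma has_2jet_unique:
  assumes "has_2jet f a b c" "has_2jet g a' b' c'" "\<forall>\<^sub>F t in nhds 0. f t = g t"
  shows "a = a'" "b = b'" "c = c'"
proof -
  obtain f' where f': "\<forall>\<^sub>F t in nhds 0. (f has_real_derivative f' t) (at t)"
    "(f has_real_derivative b) (at 0)" "(f' has_real_derivative c) (at 0)" "f 0 = a" "f' 0 = b"
    by (rule has_2jetE[OF assms(1)])
  obtain g' where g': "\<forall>\<^sub>F t in nhds 0. (g has_real_derivative g' t) (at t)"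
    "(g has_real_derivative b') (at 0)" "(g' has_real_derivative c') (at 0)" "g 0 = a'" "g' 0 = b'"
    by (rule has_2jetE[OF assms(2)])
  show "a = a'" using eventually_nhds_x_imp_x[OF assms(3)] f' g' by simp
  have "\<forall>\<^sub>F t in nhds 0. \<forall>\<^sub>F s in nhds t. f s = g s"
    using assms(3) by (simp add: eventually_eventually)
  then have "\<forall>\<^sub>F t in nhds 0. f' t = g' t"
    using f'(1) g'(1)
  proof eventually_elim
    case (elim t)
    then have "(f has_real_derivative g' t) (at t)"
      using DERIV_cong_ev[OF refl elim(1) refl] by simp
    then show ?case using elim(2) DERIV_unique by blast
  qed
  note eq = this
  show "b = b'"
    using eventually_nhds_x_imp_x[OF eq] f' g' by simp
  have "(f' has_real_derivative c') (at 0)"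
    using DERIV_cong_ev[OF refl eq refl] g'(3) by simp
  then show "c = c'"
    using f'(3) DERIV_unique by blast
qed

lemma has_2jet_const: "has_2jet (\<lambda>t. k) k 0 0"
  using has_2jetI[of "\<lambda>t. k" "\<lambda>t. 0" 0] by simp

lemma has_2jet_ident: "has_2jet (\<lambda>t. t) 0 1 0"
  using has_2jetI[of "\<lambda>t. t" "\<lambda>t. 1" 0] by simp

lemma has_2jet_add:
  assumes "has_2jet f a b c" "has_2jet g a' b' c'"
  shows "has_2jet (\<lambda>t. f t + g t) (a + a') (b + b') (c + c')"
proof -
  obtain f' where f': "\<forall>\<^sub>F t in nhds 0. (f has_real_derivative f' t) (at t)"
    "(f has_real_derivative b) (at 0)" "(f' has_real_derivative c) (at 0)" "f 0 = a" "f' 0 = b"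
    by (rule has_2jetE[OF assms(1)])
  obtain g' where g': "\<forall>\<^sub>F t in nhds 0. (g has_real_derivative g' t) (at t)"
    "(g has_real_derivative b') (at 0)" "(g' has_real_derivative c') (at 0)" "g 0 = a'" "g' 0 = b'"
    by (rule has_2jetE[OF assms(2)])
  have "\<forall>\<^sub>F t in nhds 0. ((\<lambda>t. f t + g t) has_real_derivative f' t + g' t) (at t)"
    using f'(1) g'(1) by eventually_elim (rule DERIV_add)
  from has_2jetI[OF this DERIV_add[OF f'(3) g'(3)]] show ?thesis
    by (simp add: f' g')
qed

lemma has_2jet_mult:
  assumes "has_2jet f a b c" "has_2jet g a' b' c'"
  shows "has_2jet (\<lambda>t. f t * g t) (a * a') (b * a' + a * b') (c * a' + 2 * b * b' + a * c')"
proof -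
  obtain f' where f': "\<forall>\<^sub>F t in nhds 0. (f has_real_derivative f' t) (at t)"
    "(f has_real_derivative b) (at 0)" "(f' has_real_derivative c) (at 0)" "f 0 = a" "f' 0 = b"
    by (rule has_2jetE[OF assms(1)])
  obtain g' where g': "\<forall>\<^sub>F t in nhds 0. (g has_real_derivative g' t) (at t)"
    "(g has_real_derivative b') (at 0)" "(g' has_real_derivative c') (at 0)" "g 0 = a'" "g' 0 = b'"
    by (rule has_2jetE[OF assms(2)])
  have "\<forall>\<^sub>F t in nhds 0. ((\<lambda>t. f t * g t) has_real_derivative f' t * g t + f t * g' t) (at t)"
    using f'(1) g'(1) by eventually_elim (auto intro!: derivative_eq_intros)
  moreover have "((\<lambda>t. f' t * g t + f t * g' t) has_real_derivative c * a' + 2 * b * b' + a * c') (at 0)"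
    using f' g' by (auto intro!: derivative_eq_intros)
  ultimately have "has_2jet (\<lambda>t. f t * g t) (f 0 * g 0) (f' 0 * g 0 + f 0 * g' 0)
      (c * a' + 2 * b * b' + a * c')"
    by (rule has_2jetI)
  then show ?thesis by (simp add: f' g')
qed

lemma has_2jet_cmult: "has_2jet f a b c \<Longrightarrow> has_2jet (\<lambda>t. k * f t) (k * a) (k * b) (k * c)"
  using has_2jet_mult[OF has_2jet_const] by fastforce

lemma has_2jet_power:
  assumes "has_2jet f a b c"
  shows "has_2jet (\<lambda>t. f t ^ (n + 2)) (a ^ (n + 2)) (of_nat (n + 2) * a ^ (n + 1) * b)
    (of_nat ((n + 2) * (n + 1)) * a ^ n * b\<^sup>2 + of_nat (n + 2) * a ^ (n + 1) * c)"
proof (induction n)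
  case 0
  then show ?case
    using has_2jet_mult[OF assms assms] by (simp add: power2_eq_square algebra_simps)
next
  case (Suc n)
  then show ?case
    using has_2jet_mult[OF assms Suc] by (simp add: power2_eq_square algebra_simps)
qed

lemma has_2jet_compose:
  assumes "has_2jet f 0 b c" "has_2jet g a' b' c'"
  shows "has_2jet (\<lambda>t. g (f t)) a' (b' * b) (c' * b\<^sup>2 + b' * c)"
proof -
  obtain f' where f': "\<forall>\<^sub>F t in nhds 0. (f has_real_derivative f' t) (at t)"
    "(f has_real_derivative b) (at 0)" "(f' has_real_derivative c) (at 0)" "f 0 = 0" "f' 0 = b"
    by (rule has_2jetE[OF assms(1)])
  obtain g' where g': "\<forall>\<^sub>F t in nhds 0. (g has_real_derivative g' t) (at t)"
    "(g has_real_derivative b') (at 0)" "(g' has_real_derivative c') (at 0)" "g 0 = a'" "g' 0 = b'"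
    by (rule has_2jetE[OF assms(2)])
  have "filterlim f (nhds (f 0)) (nhds 0)"
    using DERIV_isCont[OF f'(2)] by (simp add: isCont_def tendsto_at_iff_tendsto_nhds)
  then have "\<forall>\<^sub>F t in nhds 0. (g has_real_derivative g' (f t)) (at (f t))"
    using g'(1) f'(4) by (auto intro: filterlim_compose eventually_compose_filterlim)
  then have "\<forall>\<^sub>F t in nhds 0. ((\<lambda>t. g (f t)) has_real_derivative g' (f t) * f' t) (at t)"
    using f'(1) by eventually_elim (rule DERIV_chain2)
  moreover have "((\<lambda>t. g' (f t) * f' t) has_real_derivative c' * b\<^sup>2 + b' * c) (at 0)"
    using f' g' by (auto intro!: derivative_eq_intros DERIV_chain2[of g' c' f] simp: power2_eq_square)
  ultimately have "has_2jet (\<lambda>t. g (f t)) (g (f 0)) (g' (f 0) * f' 0) (c' * b\<^sup>2 + b' * c)"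
    by (rule has_2jetI)
  then show ?thesis by (simp add: f' g')
qed

lemma smooth_on_has_real_derivative:
  "smooth_on S f \<Longrightarrow> t \<in> S \<Longrightarrow> (nderiv n f has_real_derivative nderiv (Suc n) f t) (at t)"
  unfolding has_real_derivative_iff_has_vector_derivative by (rule smooth_on_has_nderiv)

lemma smooth_on_has_2jet:
  assumes "open S" "0 \<in> S" "smooth_on S f"
  shows "has_2jet f (f 0) (nderiv 1 f 0) (nderiv 2 f 0)"
proof (rule has_2jetI)
  show "\<forall>\<^sub>F t in nhds 0. (f has_real_derivative nderiv 1 f t) (at t)"
    using smooth_on_has_real_derivative[OF assms(3), of _ 0] eventually_nhds_in_open[OF assms(1,2)]
    by (auto simp: nderiv_0 elim: eventually_mono)
  show "(nderiv 1 f has_real_derivative nderiv 2 f 0) (at 0)"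
    using smooth_on_has_real_derivative[OF assms(3,2), of 1] by (simp add: numeral_2_eq_2)
qed

text \<open>
  The \<open>k\<close>-th derivative at \<open>0\<close> of a dilation mean is the \<open>k\<close>-th moment of the weight times the \<open>k\<close>-th
  derivative of \<open>h\<close>.
\<close>

lemma has_2jet_dilation_mean:
  assumes "0 < d" "continuous_on {0..1} \<phi>" "smooth_on {-d<..<d} h" "has_2jet h h0 h1 h2"
  shows "has_2jet (dilation_mean \<phi> h) (integral {0..1} \<phi> * h0)
    (integral {0..1} (\<lambda>v. v * \<phi> v) * h1) (integral {0..1} (\<lambda>v. v * (v * \<phi> v)) * h2)"
proof -
  have h: "h0 = h 0" "h1 = nderiv 1 h 0" "h2 = nderiv 2 h 0"
    using has_2jet_unique[OF assms(4) smooth_on_has_2jet[OF _ _ assms(3)]] assms(1) by auto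
  have 0: "(0::real) \<in> {-d<..<d}" using assms(1) by simp
  have D: "(dilation_mean \<psi> (nderiv n h) has_real_derivative
      dilation_mean (\<lambda>v. v * \<psi> v) (nderiv (Suc n) h) t) (at t)"
    if "t \<in> {-d<..<d}" "continuous_on {0..1} \<psi>" for \<psi> n t
    by (rule dilation_mean_has_derivative[OF that(2) _ _ that(1)])
      (use assms(3) in \<open>auto intro!: smooth_on_has_real_derivative
        smooth_on_imp_continuous_on[OF smooth_on_nderiv]\<close>)
  have "\<forall>\<^sub>F t in nhds 0. (dilation_mean \<phi> h has_real_derivative
      dilation_mean (\<lambda>v. v * \<phi> v) (nderiv 1 h) t) (at t)"
    using D[of _ \<phi> 0] assms(2) eventually_nhds_in_open[OF _ 0]
    by (auto simp: nderiv_0 elim: eventually_mono)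
  from has_2jetI[OF this D[OF 0, of "\<lambda>v. v * \<phi> v" 1]] show ?thesis
    by (simp add: h dilation_mean_0 numeral_2_eq_2 assms(2) continuous_intros)
qed

lemma integral_powr_unit:
  fixes a :: real
  shows "-1 < a \<Longrightarrow> integral {0..1} (\<lambda>v. v powr a) = 1 / (a + 1)"
  using has_integral_powr_from_0[of a 1] by (simp add: integral_unique)

lemma has_2jet_dilation_mean_powr:
  assumes "0 < a" "0 < d" "smooth_on {-d<..<d} h" "has_2jet h h0 h1 h2"
  shows "has_2jet (dilation_mean (\<lambda>v. v powr a) h) (h0 / (a + 1)) (h1 / (a + 2)) (h2 / (a + 3))"
proof -
  have cont: "continuous_on {0..1} (\<lambda>v. v powr a)"
    using assms(1) by (intro continuous_on_powr' continuous_intros) auto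
  have "integral {0..1} (\<lambda>v. v * v powr a) = integral {0..1} (\<lambda>v. v powr (1 + a))"
    "integral {0..1} (\<lambda>v. v * (v * v powr a)) = integral {0..1} (\<lambda>v. v powr (2 + a))"
    by (auto intro!: integral_cong simp: powr_mult_base)
  then show ?thesis
    using has_2jet_dilation_mean[OF assms(2) cont assms(3,4)] assms(1)
    by (simp add: integral_powr_unit add.commute)
qed

lemma has_2jet_dilation_mean_one:
  assumes "0 < d" "smooth_on {-d<..<d} h" "has_2jet h h0 h1 h2"
  shows "has_2jet (dilation_mean (\<lambda>_. 1) h) h0 (h1 / 2) (h2 / 3)"
proof -
  have I: "integral {0..1} (\<lambda>v. v) * x = x / 2" "integral {0..1} (\<lambda>v. v * v) * x = x / 3" for x :: real
    using integral_powr_unit[of 1] integral_powr_unit[of 2]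
      integral_cong[of "{0..1}" "\<lambda>v. v powr 2" "\<lambda>v. v * v :: real"]
      integral_cong[of "{0..1}" "\<lambda>v. v powr 1" "\<lambda>v. v :: real"]
    by (simp_all add: power2_eq_square)
  show ?thesis
    using has_2jet_dilation_mean[OF assms(1) _ assms(2,3), of "\<lambda>_. 1"] by (simp add: I)
qed

section \<open>The bracket along a plane curve\<close>

declare One_nat_def [simp del]

lemma bounded_bilinear_bracket: "bounded_bilinear bracket"
  unfolding bilinear_conv_bounded_bilinear[symmetric] bilinear_def
  by (auto intro!: linearI simp: bracket_def algebra_simps)

lemma bracket_self [simp]: "bracket a a = 0"
  by (simp add: bracket_def)

lemma bracket_swap: "bracket b a = - bracket a b"
  by (simp add: bracket_def)

text \<open>
  The Pluecker relation, which holds because four vectors in the plane span at most two dimensions.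
\<close>

lemma bracket_pluecker: "bracket a b * bracket c d - bracket a c * bracket b d + bracket a d * bracket b c = 0"
  by (simp add: bracket_def algebra_simps)

abbreviation (input) deriv_bracket :: "(real \<Rightarrow> real^2) \<Rightarrow> nat \<Rightarrow> nat \<Rightarrow> real \<Rightarrow> real" where
  "deriv_bracket \<gamma> i j t \<equiv> bracket (nderiv i \<gamma> t) (nderiv j \<gamma> t)"

lemma deriv_bracket_has_derivative:
  assumes "smooth_on S \<gamma>" "t \<in> S"
  shows "(deriv_bracket \<gamma> i j has_real_derivative
    deriv_bracket \<gamma> (Suc i) j t + deriv_bracket \<gamma> i (Suc j) t) (at t)"
  unfolding has_real_derivative_iff_has_vector_derivative
  using bounded_bilinear.has_vector_derivative[OF bounded_bilinear_bracket
    smooth_on_has_nderiv[OF assms, of i] smooth_on_has_nderiv[OF assms, of j]]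
  by (simp add: add.commute)

lemma smooth_on_deriv_bracket: "open S \<Longrightarrow> smooth_on S \<gamma> \<Longrightarrow> smooth_on S (deriv_bracket \<gamma> i j)"
  by (intro smooth_on_bilinear[OF bounded_bilinear_bracket] smooth_on_nderiv)

lemma deriv_bracket_has_2jet:
  assumes "open S" "smooth_on S \<gamma>" "0 \<in> S"
  shows "has_2jet (deriv_bracket \<gamma> i j) (deriv_bracket \<gamma> i j 0)
    (deriv_bracket \<gamma> (Suc i) j 0 + deriv_bracket \<gamma> i (Suc j) 0)
    (deriv_bracket \<gamma> (Suc (Suc i)) j 0 + 2 * deriv_bracket \<gamma> (Suc i) (Suc j) 0
      + deriv_bracket \<gamma> i (Suc (Suc j)) 0)"
proof -
  have "\<forall>\<^sub>F t in nhds 0. (deriv_bracket \<gamma> i j has_real_derivative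
      deriv_bracket \<gamma> (Suc i) j t + deriv_bracket \<gamma> i (Suc j) t) (at t)"
    using eventually_nhds_in_open[OF assms(1,3)]
    by (rule eventually_mono) (rule deriv_bracket_has_derivative[OF assms(2)])
  moreover have "((\<lambda>t. deriv_bracket \<gamma> (Suc i) j t + deriv_bracket \<gamma> i (Suc j) t) has_real_derivative
      deriv_bracket \<gamma> (Suc (Suc i)) j 0 + 2 * deriv_bracket \<gamma> (Suc i) (Suc j) 0
      + deriv_bracket \<gamma> i (Suc (Suc j)) 0) (at 0)"
    using DERIV_add[OF deriv_bracket_has_derivative[OF assms(2,3), of "Suc i" j]
        deriv_bracket_has_derivative[OF assms(2,3), of i "Suc j"]]
    by (simp add: algebra_simps)
  ultimately show ?thesis by (rule has_2jetI)
qed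

section \<open>Curvature near a generic inflection point\<close>

lemma smooth_atI: "open S \<Longrightarrow> t \<in> S \<Longrightarrow> smooth_on S f \<Longrightarrow> smooth_at t f"
  by (auto simp: smooth_at_def)

text \<open>
  The elimination behind the forward direction. In the intended reading \<open>a\<close>, \<open>A\<close>, \<open>q\<close>, \<open>Q\<close>, \<open>B\<close> are the brackets
  \<open>[1,3]\<close>, \<open>[1,4]\<close>, \<open>[2,3]\<close>, \<open>[2,4]\<close>, \<open>[1,5]\<close> of derivatives of \<open>\<gamma>\<close> at \<open>0\<close>, the triple \<open>x\<close>, \<open>y\<close>, \<open>z\<close> is the 2-jet of
  \<open>\<omega> = |w|^(1/3)\<close>, and the factors \<open>3/4\<close>, \<open>3/7\<close>, \<open>3/10\<close> are the moments \<open>1 / (k + 4/3)\<close> of the weight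
  \<open>v^(1/3)\<close>. The assumptions labelled \<open>F\<close> compare the 2-jets of \<open>9 \<omega>^8 F\<close> and \<open>\<sigma>\<^sup>2 N\<close>.
\<close>

lemma curvature_jet_algebra:
  fixes \<epsilon> a A q Q B x y z F0 F1 F2 N0 N1 N2 s0 s1 s2 :: real
  assumes "\<epsilon> * \<epsilon> = 1" "0 < x" "a * Q = A * q"
    and \<omega>: "x ^ 3 = \<epsilon> * a" "3 * x\<^sup>2 * y = \<epsilon> * ((A + q) / 2)" "6 * x * y\<^sup>2 + 3 * x\<^sup>2 * z = \<epsilon> * ((2 * Q + B) / 3)"
    and s: "s0 = 3/4 * x" "s1 = 3/7 * y" "s2 = 3/10 * z"
    and N: "N0 = - 5 * a\<^sup>2" "N1 = a * (2 * q - 7 * A)"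
      "N2 = 3 * ((A + q) * A + 2 * a * (Q + B)) + 12 * ((A + q) * q + 2 * a * Q) - 10 * ((A + q)\<^sup>2 + a * (2 * Q + B))"
    and F: "F0 * (9 * x ^ 8) = s0\<^sup>2 * N0"
      "F1 * (9 * x ^ 8) + F0 * (72 * x ^ 7 * y) = 2 * s0 * s1 * N0 + s0\<^sup>2 * N1"
      "F2 * (9 * x ^ 8) + 2 * F1 * (72 * x ^ 7 * y) + F0 * (504 * x ^ 6 * y\<^sup>2 + 72 * x ^ 7 * z)
        = (2 * s1\<^sup>2 + 2 * s0 * s2) * N0 + 4 * s0 * s1 * N1 + s0\<^sup>2 * N2"
  shows "F0 = - 5/16" "F1 * x ^ 3 = - 9/112 * (\<epsilon> * (A - 6 * q))"
    "- (9/7) * ((A + q) / a) * F1 + 32 * F1\<^sup>2 + 9 * F2 = 0"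
proof -
  have x0: "x \<noteq> 0" using assms(2) by simp
  \<comment> \<open>Scaled so that all brackets become \<open>\<epsilon>\<close> times a polynomial in \<open>x\<close>, \<open>y\<close>, \<open>z\<close>, \<open>k\<close>.\<close>
  define k where "k = \<epsilon> * q / x\<^sup>2"
  have q: "q = \<epsilon> * x\<^sup>2 * k"
    using x0 assms(1) by (simp add: k_def)
  have e: "\<epsilon> * (\<epsilon> * r) = r" for r
    using assms(1) by (metis mult.assoc mult_1)
  have e2: "\<epsilon>\<^sup>2 = 1" using assms(1) by (simp add: power2_eq_square)
  have a: "a = \<epsilon> * x ^ 3"
    using \<omega>(1) e by simp
  have A: "A = \<epsilon> * x\<^sup>2 * (6 * y - k)"
  proof -
    have "\<epsilon> * (6 * x\<^sup>2 * y) = \<epsilon> * (\<epsilon> * (A + q))"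
      using \<omega>(2) by simp
    then show ?thesis unfolding e using q by (simp add: algebra_simps)
  qed
  have Q: "Q = \<epsilon> * x * k * (6 * y - k)"
  proof -
    have "\<epsilon> * (a * Q) = \<epsilon> * (A * q)" using assms(3) by simp
    then have "x ^ 3 * Q = x ^ 3 * (\<epsilon> * x * k * (6 * y - k))"
      unfolding a A q using e2 e by (simp add: power2_eq_square power3_eq_cube mult_ac)
    then show ?thesis using x0 by simp
  qed
  have B: "B = \<epsilon> * (18 * x * y\<^sup>2 + 9 * x\<^sup>2 * z) - 2 * Q"
  proof -
    have "\<epsilon> * (18 * x * y\<^sup>2 + 9 * x\<^sup>2 * z) = \<epsilon> * (\<epsilon> * (2 * Q + B))"
      using \<omega>(3) by (simp add: algebra_simps)
    then show ?thesis unfolding e by simp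
  qed
  have N0: "N0 = - 5 * x ^ 6"
    unfolding N a using e2 by (simp add: power_mult_distrib flip: power_mult)
  have N1: "N1 = x ^ 5 * (9 * k - 42 * y)"
    unfolding N a A q using e2 by algebra
  have N2: "N2 = 3 * (x ^ 4 * (6 * y * (6 * y - k)) + 2 * x ^ 4 * (18 * y\<^sup>2 + 9 * x * z - k * (6 * y - k)))
     + 12 * (6 * x ^ 4 * y * k + 2 * x ^ 4 * k * (6 * y - k)) - 10 * (36 * x ^ 4 * y\<^sup>2 + x ^ 4 * (18 * y\<^sup>2 + 9 * x * z))"
    unfolding N B Q a A q using e2 by algebra
  show F0: "F0 = - 5/16"
  proof -
    have "(9 * x ^ 8) * F0 = (9 * x ^ 8) * (- 5/16)"
      using F(1) unfolding s N0 by algebra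
    then show ?thesis using x0 by (simp only: mult_cancel_left) simp
  qed
  have F1: "F1 * x = - 9/112 * (6 * y - 7 * k)"
  proof -
    have "(9 * x ^ 7) * (F1 * x) = (9 * x ^ 7) * (- 9/112 * (6 * y - 7 * k))"
      using F(2) unfolding s N0 N1 F0 by algebra
    then show ?thesis using x0 by (simp only: mult_cancel_left) simp
  qed
  show "F1 * x ^ 3 = - 9/112 * (\<epsilon> * (A - 6 * q))"
    unfolding A q using F1 e2 by algebra
  \<comment> \<open>The claimed identity, multiplied by \<open>x\<^sup>2\<close> and solved for \<open>F2\<close>.\<close>
  have F2: "9 * (F2 * x\<^sup>2) = - (54/7) * y * (F1 * x) * (-1) - 32 * (F1 * x)\<^sup>2"
  proof -
    have "x ^ 6 * (9 * (F2 * x\<^sup>2)) = x ^ 6 * (- (54/7) * y * (F1 * x) * (-1) - 32 * (F1 * x)\<^sup>2)"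
      using F(3) unfolding s N0 N1 N2 F0 using F1 by algebra
    then show ?thesis using x0 by simp
  qed
  have r: "(A + q) / a = 6 * y / x"
    using assms(1) x0 unfolding A q a by (auto simp: field_simps power2_eq_square power3_eq_cube)
  have "(- (9/7) * ((A + q) / a) * F1 + 32 * F1\<^sup>2 + 9 * F2) * x\<^sup>2
    = - (54/7) * y * (F1 * x) + 32 * (F1 * x)\<^sup>2 + 9 * (F2 * x\<^sup>2)"
    unfolding r using x0 by (simp add: field_simps power2_eq_square)
  also have "\<dots> = 0" unfolding F2 by simp
  finally show "- (9/7) * ((A + q) / a) * F1 + 32 * F1\<^sup>2 + 9 * F2 = 0"
    using x0 by simp
qed

text \<open>
  A curve on an interval around a generic inflection point, so short that \<open>[\<gamma>', \<gamma>''']\<close> keeps its sign. Then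
  \<open>w\<close> has that sign as well, and all auxiliary functions are smooth on the whole interval.
\<close>

locale inflection_germ =
  fixes \<gamma> :: "real \<Rightarrow> real^2" and d :: real
  assumes d_pos: "0 < d"
    and smooth_curve: "smooth_on {-d<..<d} \<gamma>"
    and inflection: "deriv_bracket \<gamma> 1 2 0 = 0"
    and generic: "\<And>t. t \<in> {-d<..<d} \<Longrightarrow> 0 < sgn (deriv_bracket \<gamma> 1 3 0) * deriv_bracket \<gamma> 1 3 t"
begin

definition \<epsilon> :: real where "\<epsilon> = sgn (deriv_bracket \<gamma> 1 3 0)"

text \<open>
  The bracket \<open>[\<gamma>', \<gamma>'']\<close> is \<open>t\<close> times this function.
\<close>

definition w :: "real \<Rightarrow> real" where "w = dilation_mean (\<lambda>_. 1) (deriv_bracket \<gamma> 1 3)"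

definition \<omega> :: "real \<Rightarrow> real" where "\<omega> t = (\<epsilon> * w t) powr (1/3)"

text \<open>
  The affine arclength is \<open>t |t|^(1/3)\<close> times this function.
\<close>

definition \<sigma> :: "real \<Rightarrow> real" where "\<sigma> = dilation_mean (\<lambda>v. v powr (1/3)) \<omega>"

text \<open>
  The 3/4-arclength is \<open>t\<close> times this function.
\<close>

definition \<rho> :: "real \<Rightarrow> real" where "\<rho> t = \<sigma> t powr (3/4)"

text \<open>
  The numerator of the affine curvature.
\<close>

definition N :: "real \<Rightarrow> real" where
  "N t = 3 * (deriv_bracket \<gamma> 1 2 t * deriv_bracket \<gamma> 1 4 t)
    + 12 * (deriv_bracket \<gamma> 1 2 t * deriv_bracket \<gamma> 2 3 t)
    + (-5) * deriv_bracket \<gamma> 1 3 t ^ 2"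

text \<open>
  The normalized affine curvature in a form that makes sense, and is smooth, at \<open>t = 0\<close>.
\<close>

definition F :: "real \<Rightarrow> real" where "F t = \<sigma> t ^ 2 * N t / (9 * \<omega> t ^ 8)"

lemma zero_mem: "0 \<in> {-d<..<d}"
  using d_pos by simp

lemma bracket_deriv: "t \<in> {-d<..<d} \<Longrightarrow>
    (deriv_bracket \<gamma> 1 2 has_real_derivative deriv_bracket \<gamma> 1 3 t) (at t)"
  using deriv_bracket_has_derivative[OF smooth_curve, of t 1 2] by (simp add: numeral_2_eq_2 numeral_3_eq_3)

lemma bracket_eq: "t \<in> {-d<..<d} \<Longrightarrow> deriv_bracket \<gamma> 1 2 t = t * w t"
  using dilation_mean_antiderivative[OF bracket_deriv] inflection by (simp add: w_def)

lemma smooth_w: "smooth_on {-d<..<d} w"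
  unfolding w_def by (intro smooth_on_dilation_mean smooth_on_deriv_bracket smooth_curve) auto

lemma \<epsilon>_square: "\<epsilon> * \<epsilon> = 1"
  using generic[OF zero_mem] by (auto simp: \<epsilon>_def sgn_if split: if_splits)

lemma \<epsilon>_w_pos:
  assumes "t \<in> {-d<..<d}"
  shows "0 < \<epsilon> * w t"
proof -
  have "continuous_on {-d<..<d} (\<lambda>t. \<epsilon> * deriv_bracket \<gamma> 1 3 t)"
    using smooth_on_imp_continuous_on[OF smooth_on_deriv_bracket[OF _ smooth_curve]]
    by (intro continuous_intros) auto
  then have "0 < dilation_mean (\<lambda>_. 1) (\<lambda>t. \<epsilon> * deriv_bracket \<gamma> 1 3 t) t"
    by (intro dilation_mean_pos[OF _ _ _ _ assms]) (use generic in \<open>auto simp: \<epsilon>_def\<close>)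
  then show ?thesis by (simp add: w_def dilation_mean_def)
qed

lemma abs_w: "t \<in> {-d<..<d} \<Longrightarrow> \<bar>w t\<bar> = \<epsilon> * w t"
  using \<epsilon>_w_pos[of t] by (auto simp: \<epsilon>_def sgn_if zero_less_mult_iff split: if_splits)

lemma \<omega>_pos: "t \<in> {-d<..<d} \<Longrightarrow> 0 < \<omega> t"
  using \<epsilon>_w_pos[of t] unfolding \<omega>_def by (metis powr_gt_zero less_irrefl)

lemma smooth_\<omega>: "smooth_on {-d<..<d} \<omega>"
  unfolding \<omega>_def[abs_def]
  by (intro smooth_on_powr smooth_on_mult smooth_on_const smooth_w \<epsilon>_w_pos) auto

lemma \<omega>_cube: "t \<in> {-d<..<d} \<Longrightarrow> \<omega> t ^ 3 = \<epsilon> * w t"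
  unfolding \<omega>_def by (subst powr_power) (use \<epsilon>_w_pos[of t] in auto)

lemma continuous_on_cuberoot: "continuous_on {0..1} (\<lambda>v::real. v powr (1/3))"
  by (intro continuous_on_powr' continuous_intros) auto

lemma \<sigma>_pos: "t \<in> {-d<..<d} \<Longrightarrow> 0 < \<sigma> t"
  unfolding \<sigma>_def
  by (rule dilation_mean_pos[OF continuous_on_cuberoot])
    (auto intro: \<omega>_pos smooth_on_imp_continuous_on smooth_\<omega>)

lemma smooth_\<sigma>: "smooth_on {-d<..<d} \<sigma>"
  unfolding \<sigma>_def by (intro smooth_on_dilation_mean continuous_on_cuberoot smooth_\<omega>)

lemma \<rho>_pos: "t \<in> {-d<..<d} \<Longrightarrow> 0 < \<rho> t"
  using \<sigma>_pos[of t] by (simp add: \<rho>_def)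

lemma smooth_\<rho>: "smooth_on {-d<..<d} \<rho>"
  unfolding \<rho>_def[abs_def] by (intro smooth_on_powr smooth_\<sigma> \<sigma>_pos) auto

lemma \<rho>_power: "t \<in> {-d<..<d} \<Longrightarrow> \<rho> t ^ 4 = \<sigma> t ^ 3"
  using \<sigma>_pos[of t] by (simp add: \<rho>_def powr_power)

lemma smooth_N: "smooth_on {-d<..<d} N"
  unfolding N_def[abs_def]
  by (intro smooth_on_add smooth_on_mult smooth_on_const smooth_on_power smooth_on_deriv_bracket smooth_curve) auto

lemma smooth_F: "smooth_on {-d<..<d} F"
proof -
  have "0 < 9 * \<omega> t ^ 8" if "t \<in> {-d<..<d}" for t
    using \<omega>_pos[OF that] by simp
  then show ?thesis
    unfolding F_def[abs_def]
    by (intro smooth_on_divide smooth_on_mult smooth_on_power smooth_on_const smooth_N smooth_\<sigma> smooth_\<omega>)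
      simp_all
qed

text \<open>
  Substituting \<open>u = t v\<close> turns \<open>|u|^(1/3) \<omega>(u)\<close> into \<open>|t|^(1/3) v^(1/3) \<omega>(t v)\<close>, and the
  factor depending only on \<open>t\<close> leaves the integral.
\<close>

lemma arclength_eq:
  assumes t: "t \<in> {-d<..<d}"
  shows "affine_arclength \<gamma> t = t * \<bar>t\<bar> powr (1/3) * \<sigma> t"
proof -
  have W: "\<bar>deriv_bracket \<gamma> 1 2 u\<bar> powr (1/3) = \<bar>u\<bar> powr (1/3) * \<omega> u" if "u \<in> {-d<..<d}" for u
    unfolding bracket_eq[OF that] abs_mult abs_w[OF that] \<omega>_def
    using \<epsilon>_w_pos[OF that] powr_mult[of "\<bar>u\<bar>" "\<epsilon> * w u" "1/3"] by simp
  have "continuous_on {-d<..<d} (deriv_bracket \<gamma> 1 2)"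
    using smooth_on_imp_continuous_on[OF smooth_on_deriv_bracket[OF _ smooth_curve]] by simp
  then have "continuous_on {-d<..<d} (\<lambda>u. \<bar>deriv_bracket \<gamma> 1 2 u\<bar> powr (1/3))"
    by (intro continuous_on_powr' continuous_intros) auto
  then have "affine_arclength \<gamma> t = t * dilation_mean (\<lambda>_. 1) (\<lambda>u. \<bar>deriv_bracket \<gamma> 1 2 u\<bar> powr (1/3)) t"
    unfolding affine_arclength_def by (rule interval_integral_eq_dilation_mean[OF _ t])
  also have "dilation_mean (\<lambda>_. 1) (\<lambda>u. \<bar>deriv_bracket \<gamma> 1 2 u\<bar> powr (1/3)) t
      = integral {0..1} (\<lambda>v. \<bar>t\<bar> powr (1/3) * (v powr (1/3) * \<omega> (t * v)))"
    unfolding dilation_mean_def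
    by (rule integral_cong) (simp add: W[OF scaled_mem_symmetric_interval[OF t]] abs_mult powr_mult)
  finally show ?thesis by (simp add: \<sigma>_def dilation_mean_def)
qed

lemma three_quarter_arclength_eq:
  assumes t: "t \<in> {-d<..<d}"
  shows "three_quarter_arclength \<gamma> t = t * \<rho> t"
proof (cases "t = 0")
  case True
  then show ?thesis by (simp add: three_quarter_arclength_def)
next
  case False
  have "(\<bar>t\<bar> * \<bar>t\<bar> powr (1/3)) powr (3/4) = \<bar>t\<bar>"
    using False by (simp add: powr_mult_base powr_powr)
  then have "\<bar>affine_arclength \<gamma> t\<bar> powr (3/4) = \<bar>t\<bar> * \<rho> t"
    using \<sigma>_pos[OF t] by (simp add: arclength_eq[OF t] abs_mult powr_mult \<rho>_def)
  then show ?thesis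
    by (simp add: three_quarter_arclength_def sgn_if)
qed

text \<open>
  Both \<open>s\<^sup>2\<close> and \<open>|[\<gamma>', \<gamma>'']|^(8/3)\<close> carry the factor \<open>|t|^(8/3)\<close>, which cancels.
\<close>

lemma curvature_eq:
  assumes t: "t \<in> {-d<..<d}" "t \<noteq> 0"
  shows "(affine_arclength \<gamma> t)\<^sup>2 * affine_curvature \<gamma> t = F t"
proof -
  have "\<bar>deriv_bracket \<gamma> 1 2 t\<bar> = \<bar>t\<bar> * \<omega> t ^ 3"
    unfolding bracket_eq[OF t(1)] abs_mult abs_w[OF t(1)] \<omega>_cube[OF t(1)] ..
  then have "\<bar>deriv_bracket \<gamma> 1 2 t\<bar> powr (8/3) = \<bar>t\<bar> powr (8/3) * (\<omega> t ^ 3) powr (8/3)"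
    using \<omega>_pos[OF t(1)] by (simp add: powr_mult)
  also have "(\<omega> t ^ 3) powr (8/3) = \<omega> t ^ 8"
    using \<omega>_pos[OF t(1)] powr_powr[of "\<omega> t" 3 "8/3"] by simp
  also have "\<bar>t\<bar> powr (8/3) = (t * \<bar>t\<bar> powr (1/3))\<^sup>2"
  proof -
    have "(t * \<bar>t\<bar> powr (1/3))\<^sup>2 = (\<bar>t\<bar> * \<bar>t\<bar> powr (1/3))\<^sup>2"
      by (simp add: power_mult_distrib)
    also have "\<dots> = \<bar>t\<bar> powr (8/3)"
      using t by (simp add: powr_mult_base powr_power)
    finally show ?thesis ..
  qed
  finally have *: "\<bar>deriv_bracket \<gamma> 1 2 t\<bar> powr (8/3) = (t * \<bar>t\<bar> powr (1/3))\<^sup>2 * \<omega> t ^ 8" .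
  have "t * \<bar>t\<bar> powr (1/3) \<noteq> 0" using t by simp
  then show ?thesis
    unfolding affine_curvature_def * arclength_eq[OF t(1)] F_def N_def
    by (simp add: power_mult_distrib mult.assoc)
qed

lemma curvature_tendsto:
  "((\<lambda>t. (affine_arclength \<gamma> t)\<^sup>2 * affine_curvature \<gamma> t) \<longlongrightarrow> F 0) (at 0)"
proof -
  have "isCont F 0"
    using smooth_on_imp_continuous_on[OF smooth_F] zero_mem by (simp add: continuous_on_eq_continuous_at)
  then have "(F \<longlongrightarrow> F 0) (at 0)"
    by (simp add: isCont_def)
  moreover have "\<forall>\<^sub>F t in at 0. F t = (affine_arclength \<gamma> t)\<^sup>2 * affine_curvature \<gamma> t"
    using eventually_nhds_in_open[OF _ zero_mem] curvature_eq
    by (auto simp: eventually_at_filter elim!: eventually_mono)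
  ultimately show ?thesis
    using filterlim_cong by fast
qed

lemma normalized_curvature_eq: "t \<in> {-d<..<d} \<Longrightarrow> normalized_affine_curvature \<gamma> t = F t"
  using curvature_eq[of t] tendsto_Lim[OF _ curvature_tendsto]
  by (auto simp: normalized_affine_curvature_def extend_at_0_def)

lemma nderiv_jet: "smooth_on {-d<..<d} h \<Longrightarrow> has_2jet h (h 0) (nderiv 1 h 0) (nderiv 2 h 0)"
  by (rule smooth_on_has_2jet[OF _ zero_mem]) simp

lemma eventually_germ: "(\<And>t. t \<in> {-d<..<d} \<Longrightarrow> P t) \<Longrightarrow> \<forall>\<^sub>F t in nhds 0. P t"
  by (rule eventually_mono[OF eventually_nhds_in_open[OF _ zero_mem]]) auto

lemma bracket_jets:
  defines "a \<equiv> deriv_bracket \<gamma> 1 3 0" and "A \<equiv> deriv_bracket \<gamma> 1 4 0"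
    and "q \<equiv> deriv_bracket \<gamma> 2 3 0" and "Q \<equiv> deriv_bracket \<gamma> 2 4 0" and "B \<equiv> deriv_bracket \<gamma> 1 5 0"
  shows "has_2jet (deriv_bracket \<gamma> 1 2) 0 a (A + q)"
    "has_2jet (deriv_bracket \<gamma> 1 3) a (A + q) (2 * Q + B)"
    "\<exists>c. has_2jet (deriv_bracket \<gamma> 1 4) A (Q + B) c"
    "\<exists>c. has_2jet (deriv_bracket \<gamma> 2 3) q Q c"
proof -
  note J = deriv_bracket_has_2jet[OF _ smooth_curve zero_mem]
  have swap: "deriv_bracket \<gamma> 3 2 0 + 2 * q + A = A + q"
    using bracket_swap[of "nderiv 3 \<gamma> 0" "nderiv 2 \<gamma> 0"] by (simp add: q_def)
  have "has_2jet (deriv_bracket \<gamma> 1 2) 0 a (deriv_bracket \<gamma> 3 2 0 + 2 * q + A)"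
    using J[of 1 2] inflection by (simp add: a_def A_def q_def)
  then show "has_2jet (deriv_bracket \<gamma> 1 2) 0 a (A + q)"
    unfolding swap .
  show "has_2jet (deriv_bracket \<gamma> 1 3) a (A + q) (2 * Q + B)"
    using J[of 1 3] by (simp add: a_def A_def q_def Q_def B_def add.commute)
  show "\<exists>c. has_2jet (deriv_bracket \<gamma> 1 4) A (Q + B) c"
    using J[of 1 4] by (auto simp: A_def Q_def B_def)
  show "\<exists>c. has_2jet (deriv_bracket \<gamma> 2 3) q Q c"
    using J[of 2 3] by (auto simp: q_def Q_def)
qed

text \<open>
  Read off from \<open>\<omega>\<^sup>3 = \<epsilon> w\<close>, where the jet of \<open>w\<close> is that of \<open>[\<gamma>', \<gamma>''']\<close> divided by \<open>1\<close>, \<open>2\<close>, \<open>3\<close>.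
\<close>

lemma \<omega>_jet_eqs:
  defines "x \<equiv> \<omega> 0" and "y \<equiv> nderiv 1 \<omega> 0" and "z \<equiv> nderiv 2 \<omega> 0"
  shows "x ^ 3 = \<epsilon> * deriv_bracket \<gamma> 1 3 0"
    "3 * x\<^sup>2 * y = \<epsilon> * ((deriv_bracket \<gamma> 1 4 0 + deriv_bracket \<gamma> 2 3 0) / 2)"
    "6 * x * y\<^sup>2 + 3 * x\<^sup>2 * z = \<epsilon> * ((2 * deriv_bracket \<gamma> 2 4 0 + deriv_bracket \<gamma> 1 5 0) / 3)"
proof -
  have w: "has_2jet (\<lambda>t. \<epsilon> * w t) (\<epsilon> * deriv_bracket \<gamma> 1 3 0)
      (\<epsilon> * ((deriv_bracket \<gamma> 1 4 0 + deriv_bracket \<gamma> 2 3 0) / 2))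
      (\<epsilon> * ((2 * deriv_bracket \<gamma> 2 4 0 + deriv_bracket \<gamma> 1 5 0) / 3))"
    unfolding w_def
    by (intro has_2jet_cmult has_2jet_dilation_mean_one[OF d_pos smooth_on_deriv_bracket[OF _ smooth_curve]]
        bracket_jets(2)) simp
  have "has_2jet (\<lambda>t. \<omega> t ^ 3) (x ^ 3) (3 * x\<^sup>2 * y) (6 * x * y\<^sup>2 + 3 * x\<^sup>2 * z)"
    using has_2jet_power[OF nderiv_jet[OF smooth_\<omega>], of 1]
    by (simp add: x_def y_def z_def)
  from has_2jet_unique[OF this w eventually_germ[OF \<omega>_cube]]
  show "x ^ 3 = \<epsilon> * deriv_bracket \<gamma> 1 3 0"
    "3 * x\<^sup>2 * y = \<epsilon> * ((deriv_bracket \<gamma> 1 4 0 + deriv_bracket \<gamma> 2 3 0) / 2)"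
    "6 * x * y\<^sup>2 + 3 * x\<^sup>2 * z = \<epsilon> * ((2 * deriv_bracket \<gamma> 2 4 0 + deriv_bracket \<gamma> 1 5 0) / 3)"
    by blast+
qed

lemma \<sigma>_jet: "has_2jet \<sigma> (3/4 * \<omega> 0) (3/7 * nderiv 1 \<omega> 0) (3/10 * nderiv 2 \<omega> 0)"
  using has_2jet_dilation_mean_powr[OF _ d_pos smooth_\<omega> nderiv_jet[OF smooth_\<omega>], of "1/3"]
  by (simp add: \<sigma>_def mult.commute)

lemma F_derivatives:
  shows "F 0 = - 5/16"
    "nderiv 1 F 0 * \<omega> 0 ^ 3 = - 9/112 * (\<epsilon> * (deriv_bracket \<gamma> 1 4 0 - 6 * deriv_bracket \<gamma> 2 3 0))"
    "- (9/7) * ((deriv_bracket \<gamma> 1 4 0 + deriv_bracket \<gamma> 2 3 0) / deriv_bracket \<gamma> 1 3 0) * nderiv 1 F 0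
      + 32 * (nderiv 1 F 0)\<^sup>2 + 9 * nderiv 2 F 0 = 0"
proof -
  define a A q Q B where "a = deriv_bracket \<gamma> 1 3 0" and "A = deriv_bracket \<gamma> 1 4 0"
    and "q = deriv_bracket \<gamma> 2 3 0" and "Q = deriv_bracket \<gamma> 2 4 0" and "B = deriv_bracket \<gamma> 1 5 0"
  define x y z where "x = \<omega> 0" and "y = nderiv 1 \<omega> 0" and "z = nderiv 2 \<omega> 0"
  define s0 s1 s2 where "s0 = 3/4 * x" and "s1 = 3/7 * y" and "s2 = 3/10 * z"
  define N0 N1 N2 where "N0 = - 5 * a\<^sup>2" and "N1 = a * (2 * q - 7 * A)"
    and "N2 = 3 * ((A + q) * A + 2 * a * (Q + B)) + 12 * ((A + q) * q + 2 * a * Q)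
      - 10 * ((A + q)\<^sup>2 + a * (2 * Q + B))"
  obtain c1 c2 where c: "has_2jet (deriv_bracket \<gamma> 1 4) A (Q + B) c1" "has_2jet (deriv_bracket \<gamma> 2 3) q Q c2"
    using bracket_jets(3,4) unfolding A_def q_def Q_def B_def by blast
  have W: "has_2jet (deriv_bracket \<gamma> 1 2) 0 a (A + q)" "has_2jet (deriv_bracket \<gamma> 1 3) a (A + q) (2 * Q + B)"
    using bracket_jets(1,2) unfolding a_def A_def q_def Q_def B_def by blast+
  have sq: "has_2jet (\<lambda>t. f t ^ 2) (u\<^sup>2) (2 * u * v) (2 * v\<^sup>2 + 2 * u * r)" if "has_2jet f u v r" for f u v r
    using has_2jet_mult[OF that that] by (simp add: power2_eq_square algebra_simps)
  have jN: "has_2jet N N0 N1 N2"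
    using has_2jet_add[OF has_2jet_add[OF has_2jet_cmult[OF has_2jet_mult[OF W(1) c(1)], of 3]
          has_2jet_cmult[OF has_2jet_mult[OF W(1) c(2)], of 12]] has_2jet_cmult[OF sq[OF W(2)], of "-5"]]
    unfolding N_def[abs_def] N0_def N1_def N2_def by (simp add: algebra_simps power2_eq_square)
  have "has_2jet \<sigma> s0 s1 s2"
    using \<sigma>_jet by (simp add: s0_def s1_def s2_def x_def y_def z_def)
  from has_2jet_mult[OF sq[OF this] jN]
  have rhs: "has_2jet (\<lambda>t. \<sigma> t ^ 2 * N t) (s0\<^sup>2 * N0) (2 * s0 * s1 * N0 + s0\<^sup>2 * N1)
      ((2 * s1\<^sup>2 + 2 * s0 * s2) * N0 + 4 * s0 * s1 * N1 + s0\<^sup>2 * N2)"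
    by (simp add: algebra_simps)
  have "has_2jet (\<lambda>t. 9 * \<omega> t ^ 8) (9 * x ^ 8) (72 * x ^ 7 * y) (504 * x ^ 6 * y\<^sup>2 + 72 * x ^ 7 * z)"
    using has_2jet_cmult[OF has_2jet_power[OF nderiv_jet[OF smooth_\<omega>], of 6], of 9]
    by (simp add: x_def y_def z_def algebra_simps)
  from has_2jet_mult[OF nderiv_jet[OF smooth_F] this]
  have lhs: "has_2jet (\<lambda>t. F t * (9 * \<omega> t ^ 8)) (F 0 * (9 * x ^ 8))
      (nderiv 1 F 0 * (9 * x ^ 8) + F 0 * (72 * x ^ 7 * y))
      (nderiv 2 F 0 * (9 * x ^ 8) + 2 * nderiv 1 F 0 * (72 * x ^ 7 * y)
        + F 0 * (504 * x ^ 6 * y\<^sup>2 + 72 * x ^ 7 * z))" .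
  have "F t * (9 * \<omega> t ^ 8) = \<sigma> t ^ 2 * N t" if "t \<in> {-d<..<d}" for t
    using \<omega>_pos[OF that] by (simp add: F_def)
  note F = has_2jet_unique[OF lhs rhs eventually_germ[OF this]]
  have pl: "a * Q = A * q"
    using bracket_pluecker[of "nderiv 1 \<gamma> 0" "nderiv 2 \<gamma> 0" "nderiv 3 \<gamma> 0" "nderiv 4 \<gamma> 0"] inflection
    by (simp add: a_def A_def q_def Q_def)
  note * = curvature_jet_algebra[OF \<epsilon>_square \<omega>_pos[OF zero_mem, folded x_def] pl
      \<omega>_jet_eqs[folded x_def y_def z_def a_def A_def q_def Q_def B_def]
      s0_def s1_def s2_def N0_def N1_def N2_def F]
  show "F 0 = - 5/16" using *(1) .
  show "nderiv 1 F 0 * \<omega> 0 ^ 3 = - 9/112 * (\<epsilon> * (deriv_bracket \<gamma> 1 4 0 - 6 * deriv_bracket \<gamma> 2 3 0))"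
    using *(2) unfolding x_def A_def q_def .
  show "- (9/7) * ((deriv_bracket \<gamma> 1 4 0 + deriv_bracket \<gamma> 2 3 0) / deriv_bracket \<gamma> 1 3 0) * nderiv 1 F 0
      + 32 * (nderiv 1 F 0)\<^sup>2 + 9 * nderiv 2 F 0 = 0"
    using *(3) unfolding a_def A_def q_def .
qed

text \<open>
  From \<open>\<rho>^4 = \<sigma>\<^sup>3\<close> the logarithmic derivative of \<open>\<rho>\<close> is \<open>3/4\<close> of that of \<open>\<sigma>\<close>, hence \<open>3/7\<close> of that of \<open>\<omega>\<close>, hence
  \<open>1/7\<close> of that of \<open>w\<close>, which is half of that of \<open>[\<gamma>', \<gamma>''']\<close>.
\<close>

lemma \<rho>_log_derivative:
  "nderiv 1 \<rho> 0 = \<rho> 0 * ((deriv_bracket \<gamma> 1 4 0 + deriv_bracket \<gamma> 2 3 0) / deriv_bracket \<gamma> 1 3 0) / 14"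
proof -
  define x y r0 r1 a b where "x = \<omega> 0" and "y = nderiv 1 \<omega> 0" and "r0 = \<rho> 0" and "r1 = nderiv 1 \<rho> 0"
    and "a = deriv_bracket \<gamma> 1 3 0" and "b = deriv_bracket \<gamma> 1 4 0 + deriv_bracket \<gamma> 2 3 0"
  have pos: "0 < x" "0 < r0"
    using \<omega>_pos[OF zero_mem] \<rho>_pos[OF zero_mem] by (simp_all add: x_def r0_def)
  have r: "r0 ^ 4 = (3/4 * x) ^ 3" "4 * r0 ^ 3 * r1 = 3 * (3/4 * x)\<^sup>2 * (3/7 * y)"
    using has_2jet_unique[OF has_2jet_power[OF nderiv_jet[OF smooth_\<rho>], of 2]
        has_2jet_power[OF \<sigma>_jet, of 1]] eventually_germ[OF \<rho>_power]
    by (simp_all add: x_def y_def r0_def r1_def)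
  have "r0 ^ 4 * (7 * x * r1) = r0 ^ 4 * (3 * y * r0)"
  proof -
    have "r0 ^ 4 * (7 * x * r1) = 7/4 * x * r0 * (4 * r0 ^ 3 * r1)"
      by algebra
    also have "\<dots> = 3 * y * r0 * (3/4 * x) ^ 3"
      unfolding r(2) by algebra
    finally show ?thesis unfolding r(1) by (simp add: algebra_simps)
  qed
  then have "7 * x * r1 = 3 * y * r0"
    using pos by simp
  moreover have "6 * y * a = b * x"
  proof -
    have "\<epsilon> * a = x ^ 3" "\<epsilon> * b = 6 * x\<^sup>2 * y"
      using \<omega>_jet_eqs(1,2) by (simp_all add: x_def y_def a_def b_def)
    then have "\<epsilon> * (6 * y * a) = \<epsilon> * (b * x)" by algebra
    then show ?thesis using \<epsilon>_square by auto
  qed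
  moreover have "a \<noteq> 0"
    using generic[OF zero_mem] by (auto simp: a_def)
  ultimately have "14 * a * r1 * (3 * x) = r0 * b * (3 * x)"
    by algebra
  then have "r1 = r0 * (b / a) / 14"
    using pos \<open>a \<noteq> 0\<close> by (simp add: field_simps)
  then show ?thesis by (simp add: r0_def r1_def a_def b_def)
qed

lemma \<tau>_jet: "has_2jet (\<lambda>t. t * \<rho> t) 0 (\<rho> 0) (2 * nderiv 1 \<rho> 0)"
  using has_2jet_mult[OF has_2jet_ident nderiv_jet[OF smooth_\<rho>]] by simp

lemma smooth_\<tau>: "smooth_on {-d<..<d} (\<lambda>t. t * \<rho> t)"
  by (intro smooth_on_mult smooth_on_ident smooth_\<rho>) simp_all

text \<open>
  The derivative of \<open>t \<rho>(t)\<close> at \<open>0\<close> is \<open>\<rho>(0) > 0\<close>, so the inverse function theorem applies on a smaller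
  interval.
\<close>

lemma \<tau>_coordinate:
  obtains e \<psi> where "0 < e" "e \<le> d"
    "homeomorphism {-e<..<e} ((\<lambda>t. t * \<rho> t) ` {-e<..<e}) (\<lambda>t. t * \<rho> t) \<psi>"
    "open ((\<lambda>t. t * \<rho> t) ` {-e<..<e})" "smooth_on ((\<lambda>t. t * \<rho> t) ` {-e<..<e}) \<psi>"
proof -
  let ?\<tau> = "\<lambda>t. t * \<rho> t"
  have "0 < nderiv 1 ?\<tau> 0"
    using has_2jet_unique(2)[OF nderiv_jet[OF smooth_\<tau>] \<tau>_jet] \<rho>_pos[OF zero_mem] by simp
  moreover have "continuous_on {-d<..<d} (nderiv 1 ?\<tau>)"
    by (intro smooth_on_imp_continuous_on smooth_on_nderiv smooth_\<tau>) simp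
  ultimately have "\<forall>\<^sub>F t in nhds 0. 0 < nderiv 1 ?\<tau> t"
    using zero_mem continuous_on_eq_continuous_at[of "{-d<..<d}" "nderiv 1 ?\<tau>"]
    by (intro order_tendstoD(1)[of _ "nderiv 1 ?\<tau> 0"]) (auto simp: isCont_def tendsto_at_iff_tendsto_nhds)
  then obtain e' where e': "0 < e'" "\<And>t. \<bar>t\<bar> < e' \<Longrightarrow> 0 < nderiv 1 ?\<tau> t"
    by (auto simp: eventually_nhds_metric dist_real_def)
  define e where "e = min e' d"
  have e: "0 < e" "e \<le> d" using e'(1) d_pos by (auto simp: e_def)
  show thesis
  proof (rule smooth_inverse[of "{-e<..<e}" ?\<tau>])
    show "smooth_on {-e<..<e} ?\<tau>"
      using smooth_\<tau> by (rule smooth_on_subset) (use e in auto)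
    show "0 < nderiv 1 ?\<tau> t" if "t \<in> {-e<..<e}" for t
      using that by (intro e') (auto simp: e_def)
  qed (use that e in auto)
qed

text \<open>
  The slope of \<open>F\<close> with respect to \<open>\<tau>\<close> at \<open>0\<close>. With \<open>x = \<omega>(0)\<close> one has \<open>\<rho>(0) = (3 x / 4)^(3/4)\<close> and
  \<open>|[\<gamma>', \<gamma>''']|^(5/4) = x^(15/4)\<close>, so the powers of \<open>x\<close> match and only the constant
  \<open>9/112 (4/3)^(3/4)\<close> has to be rewritten.
\<close>

lemma inflectional_curvature_limit_value:
  "nderiv 1 F 0 / \<rho> 0 = - (3 * root 4 3 / (28 * sqrt 2)) * affine_inflectional_curvature \<gamma> 0"
proof -
  define x m where "x = \<omega> 0" and "m = \<epsilon> * (deriv_bracket \<gamma> 1 4 0 - 6 * deriv_bracket \<gamma> 2 3 0)"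
  have x: "0 < x" using \<omega>_pos[OF zero_mem] by (simp add: x_def)
  have F1: "nderiv 1 F 0 = - 9/112 * m / x ^ 3"
    using F_derivatives(2) x by (simp add: field_simps x_def m_def)
  have r: "\<rho> 0 = (3/4) powr (3/4) * x powr (3/4)"
    unfolding \<rho>_def x_def has_2jet_value[OF \<sigma>_jet] by (rule powr_mult)
  have "\<bar>deriv_bracket \<gamma> 1 3 0\<bar> = x ^ 3"
    using \<omega>_jet_eqs(1) by (simp add: x_def \<epsilon>_def abs_sgn mult.commute)
  moreover have "(x ^ 3) powr (5/4) = x ^ 3 * x powr (3/4)"
    using powr_powr[of x 3 "5/4"] powr_add[of x 3 "3/4"] x by simp
  ultimately have \<mu>: "affine_inflectional_curvature \<gamma> 0 = m / (x ^ 3 * x powr (3/4))"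
    by (simp add: affine_inflectional_curvature_def m_def \<epsilon>_def)
  have "(4::real) powr (3/4) = 2 * sqrt 2"
  proof -
    have "(4::real) powr (3/4) = (2 powr 2) powr (3/4)" by simp
    also have "\<dots> = 2 powr (1 + 1/2)" unfolding powr_powr by simp
    also have "\<dots> = 2 * sqrt 2" unfolding powr_add by (simp add: powr_half_sqrt)
    finally show ?thesis .
  qed
  moreover have "root 4 3 * 3 powr (3/4) = (3::real)"
    by (simp add: root_powr_inverse flip: powr_add)
  ultimately have c: "root 4 3 / (28 * sqrt 2) * (3/4) powr (3/4) = (3/112 :: real)"
    unfolding powr_divide by simp
  have ne: "(3/4::real) powr (3/4) \<noteq> 0" by simp
  have "- 9/112 * m / x ^ 3 / (k * u) = - (3 * l) * (m / (x ^ 3 * u))" if "l * k = 3/112" "k \<noteq> 0" for k u l :: real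
  proof -
    have "- (3 * l) * (m / (x ^ 3 * u)) = - (3 * (l * k)) * m / x ^ 3 / (k * u)"
      using that(2) by (simp add: field_simps)
    then show ?thesis unfolding that(1) by simp
  qed
  from this[OF c ne, of "x powr (3/4)"] show ?thesis
    unfolding F1 r \<mu> by simp
qed

lemma three_quarter_coordinate:
  obtains e \<psi> where "0 < e" "e \<le> d" "open (three_quarter_arclength \<gamma> ` {-e<..<e})"
    "homeomorphism {-e<..<e} (three_quarter_arclength \<gamma> ` {-e<..<e}) (three_quarter_arclength \<gamma>) \<psi>"
    "smooth_on {-e<..<e} (three_quarter_arclength \<gamma>)"
    "smooth_on (three_quarter_arclength \<gamma> ` {-e<..<e}) \<psi>"
proof -
  obtain e \<psi> where e: "0 < e" "e \<le> d"
    "homeomorphism {-e<..<e} ((\<lambda>t. t * \<rho> t) ` {-e<..<e}) (\<lambda>t. t * \<rho> t) \<psi>"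
    "open ((\<lambda>t. t * \<rho> t) ` {-e<..<e})" "smooth_on ((\<lambda>t. t * \<rho> t) ` {-e<..<e}) \<psi>"
    by (rule \<tau>_coordinate)
  have eq: "t * \<rho> t = three_quarter_arclength \<gamma> t" if "t \<in> {-e<..<e}" for t
    using three_quarter_arclength_eq[of t] that e(2) by auto
  have im: "(\<lambda>t. t * \<rho> t) ` {-e<..<e} = three_quarter_arclength \<gamma> ` {-e<..<e}"
    using eq by (rule image_cong[OF refl])
  have "smooth_on {-e<..<e} (\<lambda>t. t * \<rho> t)"
    using smooth_\<tau> by (rule smooth_on_subset) (use e in auto)
  then have "smooth_on {-e<..<e} (three_quarter_arclength \<gamma>)"
    by (rule smooth_on_cong[rotated 2]) (use eq in auto)
  moreover have "homeomorphism {-e<..<e} (three_quarter_arclength \<gamma> ` {-e<..<e}) (three_quarter_arclength \<gamma>) \<psi>"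
    using e(3) unfolding im
    by (rule homeomorphism_cong) (use eq in auto)
  ultimately show thesis
    using that e unfolding im by blast
qed

text \<open>
  If \<open>F = g(\<tau>)\<close>, the chain rule gives \<open>32 F'\<^sup>2 + 9 F'' = \<rho>\<^sup>2 (32 g'\<^sup>2 + 9 g'') + 18 g' \<rho>'\<close> at \<open>0\<close>, and the last term
  equals the \<open>F'\<close> term of the identity for \<open>F\<close>.
\<close>

lemma normalized_curvature_in_coordinate:
  obtains g where "smooth_at 0 g" "\<forall>\<^sub>F t in nhds 0. F t = g (three_quarter_arclength \<gamma> t)"
    "32 * (nderiv 1 g 0)\<^sup>2 + 9 * nderiv 2 g 0 = 0"
proof -
  let ?\<tau> = "three_quarter_arclength \<gamma>"
  obtain e \<psi> where e: "0 < e" "e \<le> d" "open (?\<tau> ` {-e<..<e})"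
    "homeomorphism {-e<..<e} (?\<tau> ` {-e<..<e}) ?\<tau> \<psi>" "smooth_on {-e<..<e} ?\<tau>"
    "smooth_on (?\<tau> ` {-e<..<e}) \<psi>"
    by (rule three_quarter_coordinate)
  have inv: "\<psi> (?\<tau> t) = t" if "t \<in> {-e<..<e}" for t
    using e(4) that by (auto simp: homeomorphism_def)
  have sub: "\<psi> ` (?\<tau> ` {-e<..<e}) \<subseteq> {-e<..<e}"
    using e(4) by (auto simp: homeomorphism_def)
  have 0: "0 \<in> ?\<tau> ` {-e<..<e}"
    using three_quarter_arclength_eq[OF zero_mem] e(1) by (intro image_eqI[of _ _ 0]) auto
  define g where "g = (\<lambda>y. F (\<psi> y))"
  have "smooth_on {-e<..<e} F"
    using smooth_F by (rule smooth_on_subset) (use e in auto)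
  then have smooth_g: "smooth_on (?\<tau> ` {-e<..<e}) g"
    unfolding g_def by (intro smooth_on_compose[OF e(3) _ sub _ e(6)]) auto
  have ev\<tau>: "\<forall>\<^sub>F t in nhds 0. ?\<tau> t = t * \<rho> t"
    by (rule eventually_germ) (rule three_quarter_arclength_eq)
  have "\<forall>\<^sub>F t in nhds 0. t \<in> {-e<..<e}"
    by (rule eventually_nhds_in_open) (use e in auto)
  then have ev: "\<forall>\<^sub>F t in nhds 0. F t = g (?\<tau> t)"
    by (rule eventually_mono) (simp add: g_def inv)
  define a b where "a = nderiv 1 g 0" and "b = nderiv 2 g 0"
  have "has_2jet g (g 0) a b"
    unfolding a_def b_def by (rule smooth_on_has_2jet[OF e(3) 0 smooth_g])
  from has_2jet_compose[OF \<tau>_jet this]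
  have "has_2jet (\<lambda>t. g (t * \<rho> t)) (g 0) (a * \<rho> 0) (b * (\<rho> 0)\<^sup>2 + a * (2 * nderiv 1 \<rho> 0))" .
  moreover have "\<forall>\<^sub>F t in nhds 0. F t = g (t * \<rho> t)"
    using ev ev\<tau> by eventually_elim simp
  ultimately have F: "nderiv 1 F 0 = a * \<rho> 0" "nderiv 2 F 0 = b * (\<rho> 0)\<^sup>2 + a * (2 * nderiv 1 \<rho> 0)"
    using has_2jet_unique[OF nderiv_jet[OF smooth_F]] by blast+
  define c where "c = (deriv_bracket \<gamma> 1 4 0 + deriv_bracket \<gamma> 2 3 0) / deriv_bracket \<gamma> 1 3 0"
  have "- (9/7) * c * (a * \<rho> 0) + 32 * (a * \<rho> 0)\<^sup>2 + 9 * (b * (\<rho> 0)\<^sup>2 + a * (2 * (\<rho> 0 * c / 14))) = 0"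
    using F_derivatives(3) unfolding F \<rho>_log_derivative c_def .
  then have "(\<rho> 0)\<^sup>2 * (32 * a\<^sup>2 + 9 * b) = 0"
    by algebra
  then have "32 * a\<^sup>2 + 9 * b = 0"
    using \<rho>_pos[OF zero_mem] by simp
  then show thesis
    using that[OF smooth_atI[OF e(3) 0 smooth_g] ev] by (simp add: a_def b_def)
qed

lemma curvature_slope_tendsto:
  "((\<lambda>t. ((affine_arclength \<gamma> t)\<^sup>2 * affine_curvature \<gamma> t + 5/16) / three_quarter_arclength \<gamma> t)
    \<longlongrightarrow> - (3 * root 4 3 / (28 * sqrt 2)) * affine_inflectional_curvature \<gamma> 0) (at 0)"
proof -
  have "((\<lambda>t. (F t - F 0) / (t - 0)) \<longlongrightarrow> nderiv 1 F 0) (at 0)"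
    using smooth_on_has_real_derivative[OF smooth_F zero_mem, of 0]
    by (simp add: nderiv_0 has_field_derivative_iff flip: One_nat_def)
  moreover have "isCont \<rho> 0"
    using smooth_on_imp_continuous_on[OF smooth_\<rho>] zero_mem by (simp add: continuous_on_eq_continuous_at)
  ultimately have "((\<lambda>t. (F t - F 0) / (t - 0) / \<rho> t) \<longlongrightarrow> nderiv 1 F 0 / \<rho> 0) (at 0)"
    using \<rho>_pos[OF zero_mem] by (intro tendsto_divide) (simp_all add: isCont_def)
  moreover have "\<forall>\<^sub>F t in at 0. (F t - F 0) / (t - 0) / \<rho> t
      = ((affine_arclength \<gamma> t)\<^sup>2 * affine_curvature \<gamma> t + 5/16) / three_quarter_arclength \<gamma> t"
    unfolding eventually_at_filter
    by (rule eventually_germ) (auto simp: curvature_eq three_quarter_arclength_eq F_derivatives(1))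
  ultimately show ?thesis
    unfolding inflectional_curvature_limit_value[symmetric] by (rule Lim_transform_eventually)
qed

lemma nderiv_normalized_curvature: "nderiv n (normalized_affine_curvature \<gamma>) 0 = nderiv n F 0"
  by (rule nderiv_cong_open[OF _ normalized_curvature_eq zero_mem]) simp

lemma smooth_normalized_curvature: "smooth_on {-d<..<d} (normalized_affine_curvature \<gamma>)"
  by (rule smooth_on_cong[OF _ _ smooth_F]) (simp_all add: normalized_curvature_eq)

end

lemma inflection_germ_exists:
  assumes "0 \<in> I" "regular_curve I \<gamma>" "generic_inflection_point \<gamma> 0"
  shows "\<exists>d. inflection_germ \<gamma> d"
proof -
  define e where "e = sgn (deriv_bracket \<gamma> 1 3 0)"
  have I: "open I" "smooth_on I \<gamma>"
    using assms(2) by (auto simp: regular_curve_def)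
  have "continuous_on I (\<lambda>t. e * deriv_bracket \<gamma> 1 3 t)"
    by (intro continuous_intros smooth_on_imp_continuous_on smooth_on_deriv_bracket I)
  then have "open (I \<inter> (\<lambda>t. e * deriv_bracket \<gamma> 1 3 t) -` {0<..})"
    by (rule continuous_open_preimage[OF _ I(1) open_greaterThan])
  also have "I \<inter> (\<lambda>t. e * deriv_bracket \<gamma> 1 3 t) -` {0<..} = {t \<in> I. 0 < e * deriv_bracket \<gamma> 1 3 t}"
    by auto
  finally have "open {t \<in> I. 0 < e * deriv_bracket \<gamma> 1 3 t}" .
  moreover have "0 < e * deriv_bracket \<gamma> 1 3 0"
    using assms(3) by (auto simp: e_def generic_inflection_point_def sgn_if)
  ultimately obtain d where d: "0 < d" "ball 0 d \<subseteq> {t \<in> I. 0 < e * deriv_bracket \<gamma> 1 3 t}"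
    using assms(1) open_contains_ball[of "{t \<in> I. 0 < e * deriv_bracket \<gamma> 1 3 t}"] by auto
  then have "{-d<..<d} \<subseteq> {t \<in> I. 0 < e * deriv_bracket \<gamma> 1 3 t}"
    by (simp add: ball_eq_greaterThanLessThan)
  then have "inflection_germ \<gamma> d"
    using d(1) assms(3) smooth_on_subset[OF I(2)]
    by unfold_locales (auto simp: e_def generic_inflection_point_def inflection_point_def)
  then show ?thesis ..
qed

lemma generic_inflection_curvature:
  assumes "0 \<in> I" "regular_curve I \<gamma>" "generic_inflection_point \<gamma> 0"
  shows "let f = normalized_affine_curvature \<gamma>; \<tau> = three_quarter_arclength \<gamma> in
               local_coordinate_at 0 \<tau> \<and>
               smooth_at 0 f \<and>
               (\<exists>g. smooth_at 0 g \<and> (\<forall>\<^sub>F t in nhds 0. f t = g (\<tau> t)) \<and>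
                    32 * (nderiv 1 g 0)\<^sup>2 + 9 * nderiv 2 g 0 = 0) \<and>
               - (9/7) * ((bracket (nderiv 1 \<gamma> 0) (nderiv 4 \<gamma> 0)
                            + bracket (nderiv 2 \<gamma> 0) (nderiv 3 \<gamma> 0))
                          / bracket (nderiv 1 \<gamma> 0) (nderiv 3 \<gamma> 0)) * nderiv 1 f 0
                 + 32 * (nderiv 1 f 0)\<^sup>2 + 9 * nderiv 2 f 0 = 0 \<and>
               ((\<lambda>t. (affine_arclength \<gamma> t)\<^sup>2 * affine_curvature \<gamma> t) \<longlongrightarrow> - (5/16)) (at 0) \<and>
               f 0 = - (5/16) \<and>
               ((\<lambda>t. ((affine_arclength \<gamma> t)\<^sup>2 * affine_curvature \<gamma> t + 5/16) / \<tau> t)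
                  \<longlongrightarrow> - (3 * root 4 3 / (28 * sqrt 2)) * affine_inflectional_curvature \<gamma> 0) (at 0) \<and>
               ((\<forall>\<^sub>F t in nhds 0. \<tau> t = t) \<longrightarrow>
                  32 * (nderiv 1 f 0)\<^sup>2 + 9 * nderiv 2 f 0 = 0)"
proof -
  obtain d where "inflection_germ \<gamma> d"
    using inflection_germ_exists[OF assms] by blast
  then interpret inflection_germ \<gamma> d .
  let ?f = "normalized_affine_curvature \<gamma>" and ?\<tau> = "three_quarter_arclength \<gamma>"
  obtain e \<psi> where e: "0 < e" "e \<le> d" "open (?\<tau> ` {-e<..<e})"
    "homeomorphism {-e<..<e} (?\<tau> ` {-e<..<e}) ?\<tau> \<psi>" "smooth_on {-e<..<e} ?\<tau>"
    "smooth_on (?\<tau> ` {-e<..<e}) \<psi>"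
    by (rule three_quarter_coordinate)
  have coord: "local_coordinate_at 0 ?\<tau>"
    unfolding local_coordinate_at_def
    by (intro exI[of _ "{-e<..<e}"] exI[of _ "?\<tau> ` {-e<..<e}"] exI[of _ \<psi>]) (use e in auto)
  obtain g where g: "smooth_at 0 g" "\<forall>\<^sub>F t in nhds 0. F t = g (?\<tau> t)"
    "32 * (nderiv 1 g 0)\<^sup>2 + 9 * nderiv 2 g 0 = 0"
    by (rule normalized_curvature_in_coordinate)
  have "\<forall>\<^sub>F t in nhds 0. ?f t = F t"
    by (rule eventually_germ) (rule normalized_curvature_eq)
  then have fg: "\<forall>\<^sub>F t in nhds 0. ?f t = g (?\<tau> t)"
    using g(2) by eventually_elim simp
  have red: "32 * (nderiv 1 ?f 0)\<^sup>2 + 9 * nderiv 2 ?f 0 = 0" if "\<forall>\<^sub>F t in nhds 0. ?\<tau> t = t"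
  proof -
    have "\<forall>\<^sub>F t in nhds 0. F t = g t"
      using g(2) that by eventually_elim simp
    moreover obtain S where "open S" "0 \<in> S" "smooth_on S g"
      using g(1) by (auto simp: smooth_at_def)
    ultimately have "nderiv 1 F 0 = nderiv 1 g 0" "nderiv 2 F 0 = nderiv 2 g 0"
      using has_2jet_unique[OF nderiv_jet[OF smooth_F] smooth_on_has_2jet[of S g]] by blast+
    then show ?thesis using g(3) by (simp add: nderiv_normalized_curvature)
  qed
  show ?thesis
    unfolding Let_def
    using coord smooth_atI[OF _ zero_mem smooth_normalized_curvature] g(1,3) fg F_derivatives(3)
      curvature_tendsto curvature_slope_tendsto red F_derivatives(1) normalized_curvature_eq[OF zero_mem]
    by (intro conjI exI[of _ g]) (simp_all add: nderiv_normalized_curvature)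
qed

section \<open>A singular linear equation\<close>

lemma dilation_mean_dist_le:
  assumes \<phi>: "continuous_on {0..1} \<phi>" "\<And>v. v \<in> {0..1} \<Longrightarrow> \<bar>\<phi> v\<bar> \<le> 1"
    and h: "continuous_on {-d<..<d} h" "continuous_on {-d<..<d} k" and t: "t \<in> {-d<..<d}"
    and B: "\<And>v. v \<in> {0..1} \<Longrightarrow> \<bar>h (t * v) - k (t * v)\<bar> \<le> B"
  shows "\<bar>dilation_mean \<phi> h t - dilation_mean \<phi> k t\<bar> \<le> B"
proof -
  have "dilation_mean \<phi> h t - dilation_mean \<phi> k t
      = integral {0..1} (\<lambda>v. \<phi> v * h (t * v) - \<phi> v * k (t * v))"
    unfolding dilation_mean_def
    by (rule integral_diff[symmetric]) (intro dilation_mean_integrable[OF \<phi>(1) _ t] h)+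
  moreover have "norm (integral {0..1} (\<lambda>v. \<phi> v * h (t * v) - \<phi> v * k (t * v))) \<le> B * (1 - 0)"
  proof (rule integral_bound)
    show "continuous_on {0..1} (\<lambda>v. \<phi> v * h (t * v) - \<phi> v * k (t * v))"
      by (intro continuous_intros \<phi> continuous_on_compose2[OF h(1)] continuous_on_compose2[OF h(2)])
        (use t scaled_mem_symmetric_interval in auto)
    show "norm (\<phi> v * h (t * v) - \<phi> v * k (t * v)) \<le> B" if "v \<in> {0..1}" for v
    proof -
      have "\<bar>\<phi> v\<bar> * \<bar>h (t * v) - k (t * v)\<bar> \<le> 1 * B"
        using \<phi>(2)[OF that] B[OF that] by (intro mult_mono) auto
      then show ?thesis by (simp add: abs_mult flip: right_diff_distrib)
    qed
  qed simp
  ultimately show ?thesis by simp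
qed

text \<open>
  The right-hand side is \<open>c\<close> minus the integral of \<open>p u + r\<close> from \<open>0\<close> to \<open>t\<close>, where \<open>u(t) = t^(-2)\<close> times the
  integral of \<open>s V(s)\<close>. As averaging does not increase the supremum norm, the
  singular factor does no harm, and the map is a contraction on a short interval.
\<close>

lemma continuous_integral_equation_solution:
  assumes "0 < d" and p: "continuous_on {-d<..<d} p" and r: "continuous_on {-d<..<d} r"
  obtains e V where "0 < e" "e < d" "continuous_on UNIV V"
    "\<forall>t\<in>{-e<..<e}.
      V t = c - t * dilation_mean (\<lambda>_. 1) (\<lambda>s. p s * dilation_mean (\<lambda>v. v) V s + r s) t"
proof -
  have "compact (p ` {-d/2..d/2})"
    by (intro compact_continuous_image continuous_on_subset[OF p]) (use assms(1) in auto)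
  then obtain M where M: "0 < M" "\<And>t. t \<in> {-d/2..d/2} \<Longrightarrow> \<bar>p t\<bar> \<le> M"
    using compact_imp_bounded bounded_pos by (metis (no_types, lifting) image_eqI real_norm_def)
  \<comment> \<open>The contraction constant will be \<open>e M \<le> 1/2\<close>.\<close>
  define e where "e = min (d/2) (1 / (2 * M))"
  have e: "0 < e" "e \<le> d/2" "e < d" "e * M \<le> 1/2"
    using assms(1) M(1) by (auto simp: e_def min_def field_simps)
  \<comment> \<open>Clipping the argument makes the iteration act on bounded continuous functions on the whole line.\<close>
  define clip where "clip t = max (-e) (min e t)" for t :: real
  have clip: "clip t \<in> {-e..e}" "\<bar>clip t\<bar> \<le> e" "clip t \<in> {-d<..<d}" for t
    using e by (auto simp: clip_def)
  define K where "K V s = p s * dilation_mean (\<lambda>v. v) V s + r s" for V :: "real \<Rightarrow> real" and s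
  have cK: "continuous_on {-d<..<d} (K V)" if "continuous_on UNIV V" for V
    unfolding K_def[abs_def]
    by (intro continuous_intros p r continuous_on_dilation_mean continuous_on_subset[OF that]) auto
  define step where "step V t = c - clip t * dilation_mean (\<lambda>_. 1) (K V) (clip t)" for V and t :: real
  have step: "step V \<in> bcontfun" if V: "continuous_on UNIV V" for V
  proof -
    let ?g = "\<lambda>s. c - s * dilation_mean (\<lambda>_. 1) (K V) s"
    have g: "continuous_on {-e..e} ?g"
      by (rule continuous_on_subset[of "{-d<..<d}"])
        (use e in \<open>auto intro!: continuous_intros continuous_on_dilation_mean cK V\<close>)
    have "continuous_on UNIV clip"
      unfolding clip_def by (intro continuous_intros)
    then have "continuous_on UNIV (\<lambda>t. ?g (clip t))"
      by (intro continuous_on_compose2[OF g]) (use clip(1) in auto)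
    moreover have "bounded (?g ` {-e..e})"
      by (intro compact_imp_bounded compact_continuous_image g) simp
    then have "bounded (range (\<lambda>t. ?g (clip t)))"
      by (rule bounded_subset) (use clip(1) in auto)
    ultimately show ?thesis
      unfolding step_def[abs_def] bcontfun_def by simp
  qed
  define \<Phi> where "\<Phi> V = Bcontfun (step (apply_bcontfun V))" for V :: "(real, real) bcontfun"
  have \<Phi>: "apply_bcontfun (\<Phi> V) = step (apply_bcontfun V)" for V
    unfolding \<Phi>_def by (intro Bcontfun_inverse step) simp
  have "dist (\<Phi> V) (\<Phi> V') \<le> 1/2 * dist V V'" for V V'
  proof (rule dist_bound)
    fix t
    define s where "s = clip t"
    have K: "\<bar>K (apply_bcontfun V) (s * v) - K (apply_bcontfun V') (s * v)\<bar> \<le> M * dist V V'"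
      if v: "v \<in> {0..1}" for v
    proof -
      have "\<bar>s * v\<bar> \<le> e"
        using v clip(2)[of t] mult_mono[of "\<bar>s\<bar>" e v 1] e(1) by (auto simp: s_def abs_mult)
      then have sv: "s * v \<in> {-d<..<d}" "s * v \<in> {-d/2..d/2}" using e by auto
      have "\<bar>dilation_mean (\<lambda>v. v) (apply_bcontfun V) (s * v)
          - dilation_mean (\<lambda>v. v) (apply_bcontfun V') (s * v)\<bar> \<le> dist V V'"
        using dist_bounded[of V _ V']
        by (intro dilation_mean_dist_le[OF _ _ _ _ sv(1)]) (auto simp: dist_real_def)
      then have "\<bar>p (s * v)\<bar> * \<bar>dilation_mean (\<lambda>v. v) (apply_bcontfun V) (s * v)
          - dilation_mean (\<lambda>v. v) (apply_bcontfun V') (s * v)\<bar> \<le> M * dist V V'"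
        using M(2)[OF sv(2)] M(1) by (intro mult_mono) auto
      then show ?thesis by (simp add: K_def abs_mult flip: right_diff_distrib)
    qed
    have "\<bar>dilation_mean (\<lambda>_. 1) (K (apply_bcontfun V)) s
        - dilation_mean (\<lambda>_. 1) (K (apply_bcontfun V')) s\<bar> \<le> M * dist V V'"
      by (rule dilation_mean_dist_le[OF _ _ cK cK _ K]) (use clip(3) in \<open>auto simp: s_def\<close>)
    then have "\<bar>s\<bar> * \<bar>dilation_mean (\<lambda>_. 1) (K (apply_bcontfun V)) s
        - dilation_mean (\<lambda>_. 1) (K (apply_bcontfun V')) s\<bar> \<le> e * (M * dist V V')"
      using clip(2)[of t] e(1) by (intro mult_mono) (auto simp: s_def)
    also have "\<dots> \<le> 1/2 * dist V V'"
      using mult_right_mono[OF e(4), of "dist V V'"] by simp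
    finally show "dist (apply_bcontfun (\<Phi> V) t) (apply_bcontfun (\<Phi> V') t) \<le> 1/2 * dist V V'"
      unfolding \<Phi> step_def s_def[symmetric] dist_real_def
      by (simp add: abs_mult abs_minus_commute flip: right_diff_distrib)
  qed
  then have "\<exists>!V. \<Phi> V = V"
    by (intro banach_fix_type[of "1/2"]) auto
  then obtain V where "\<Phi> V = V" by blast
  then have V: "apply_bcontfun V t = step (apply_bcontfun V) t" for t
    using \<Phi>[of V] by simp
  have "apply_bcontfun V t = c - t * dilation_mean (\<lambda>_. 1)
      (\<lambda>s. p s * dilation_mean (\<lambda>v. v) (apply_bcontfun V) s + r s) t" if "t \<in> {-e<..<e}" for t
  proof -
    have "clip t = t" using that by (auto simp: clip_def)
    then show ?thesis using V[of t] by (simp add: step_def K_def[abs_def])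
  qed
  then show thesis
    by (intro that[OF e(1,3) continuous_on_apply_bcontfun] ballI)
qed

text \<open>
  Bootstrapping: if \<open>V\<close> has \<open>n\<close> derivatives, so has its mean \<open>u\<close>, and hence \<open>V' = - (p u + r)\<close>.
\<close>

lemma singular_equation_solution:
  assumes "0 < d" and p: "smooth_on {-d<..<d} p" and r: "smooth_on {-d<..<d} r"
  obtains e V where "0 < e" "e < d" "smooth_on {-e<..<e} V" "V 0 = c"
    "\<forall>t\<in>{-e<..<e}.
      (V has_real_derivative - (p t * dilation_mean (\<lambda>v. v) V t + r t)) (at t)"
proof -
  obtain e V where e: "0 < e" "e < d" "continuous_on UNIV V"
    and V: "\<forall>t\<in>{-e<..<e}.
      V t = c - t * dilation_mean (\<lambda>_. 1) (\<lambda>s. p s * dilation_mean (\<lambda>v. v) V s + r s) t"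
    by (rule continuous_integral_equation_solution[OF assms(1) p[THEN smooth_on_imp_continuous_on]
          r[THEN smooth_on_imp_continuous_on]])
  define K where "K s = p s * dilation_mean (\<lambda>v. v) V s + r s" for s
  have sub: "{-e<..<e} \<subseteq> {-d<..<d}" using e by auto
  have pr: "ck_on n {-e<..<e} p" "ck_on n {-e<..<e} r" for n
    using smooth_on_subset[OF p sub] smooth_on_subset[OF r sub] by (simp_all add: smooth_on_iff_ck_on)
  have K: "ck_on n {-e<..<e} K" if "ck_on n {-e<..<e} V" for n
    unfolding K_def[abs_def]
    by (intro ck_on_add ck_on_mult pr ck_on_dilation_mean continuous_intros that)
  have V0: "ck_on 0 {-e<..<e} V"
    using continuous_on_subset[OF e(3)] by simp
  have D: "(V has_real_derivative - K t) (at t)" if t: "t \<in> {-e<..<e}" for t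
  proof -
    have "((\<lambda>t. c - t * dilation_mean (\<lambda>_. 1) K t) has_real_derivative 0 - K t) (at t)"
      by (intro derivative_intros has_derivative_antiderivative[OF ck_on_imp_continuous_on[OF K[OF V0]] t])
    then show ?thesis
      using V t has_vector_derivative_cong_open[of "{-e<..<e}" t V "\<lambda>t. c - t * dilation_mean (\<lambda>_. 1) K t"]
      by (simp add: has_real_derivative_iff_has_vector_derivative K_def[abs_def])
  qed
  have "ck_on n {-e<..<e} V" for n
  proof (induction n)
    case 0
    then show ?case by (rule V0)
  next
    case (Suc n)
    have "ck_on n {-e<..<e} (\<lambda>t. (-1) * K t)"
      by (intro ck_on_mult ck_on_const K Suc)
    then show ?case
      by (rule ck_on_SucI[rotated]) (use D in \<open>simp add: has_real_derivative_iff_has_vector_derivative\<close>)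
  qed
  then have "smooth_on {-e<..<e} V" by (simp add: smooth_on_iff_ck_on)
  moreover have "V 0 = c" using bspec[OF V, of 0] e(1) by simp
  ultimately show thesis
    using D by (intro that[OF e(1,2), of V]) (simp_all add: K_def)
qed

lemma square_times_linear_dilation_mean:
  "t\<^sup>2 * dilation_mean (\<lambda>v. v) h t = t * dilation_mean (\<lambda>_. 1) (\<lambda>s. s * h s) t"
proof -
  have "integral {0..1} (\<lambda>v. t * (v * h (t * v))) = t * integral {0..1} (\<lambda>v. v * h (t * v))"
    by simp
  then show ?thesis
    by (simp add: dilation_mean_def power2_eq_square mult.assoc)
qed

text \<open>
  This is how the substitution works: with \<open>y = t\<^sup>2 u\<close> and \<open>u\<close> the linearly weighted mean of \<open>V\<close>, one has
  \<open>y' = t V\<close>.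
\<close>

lemma square_times_linear_dilation_mean_derivative:
  assumes "continuous_on {-d<..<d} h" "t \<in> {-d<..<d}"
  shows "((\<lambda>t. t\<^sup>2 * dilation_mean (\<lambda>v. v) h t) has_real_derivative t * h t) (at t)"
  unfolding square_times_linear_dilation_mean
  by (rule has_derivative_antiderivative[OF _ assms(2)]) (intro continuous_intros assms(1))

text \<open>
  Away from \<open>0\<close> this is \<open>(t\<^sup>2 u)' = t h\<close> divided by \<open>t\<close>; at \<open>0\<close> it is the value \<open>u(0) = h(0) / 2\<close>.
\<close>

lemma linear_dilation_mean_euler:
  assumes "smooth_on {-d<..<d} h" "t \<in> {-d<..<d}"
  defines "u \<equiv> dilation_mean (\<lambda>v. v) h"
  shows "((\<lambda>t. t * u t) has_real_derivative h t - u t) (at t)"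
proof -
  have d: "0 < d" using assms(2) by auto
  have su: "smooth_on {-d<..<d} u"
    unfolding u_def by (intro smooth_on_dilation_mean assms(1) continuous_intros)
  have D: "(u has_real_derivative nderiv 1 u s) (at s)" if "s \<in> {-d<..<d}" for s
    using smooth_on_has_real_derivative[OF su that, of 0] by (simp add: nderiv_0 flip: One_nat_def)
  have "u t + t * nderiv 1 u t = h t - u t"
  proof (cases "t = 0")
    case True
    have "integral {0..1} (\<lambda>v. v) = (1/2::real)"
      using integral_powr_unit[of 1] integral_cong[of "{0..1}" "\<lambda>v. v powr 1" "\<lambda>v. v :: real"] by simp
    then have "u 0 = h 0 / 2" by (simp add: u_def dilation_mean_0)
    then show ?thesis using True by simp
  next
    case False
    have "((\<lambda>t. t\<^sup>2 * u t) has_real_derivative 2 * t * u t + t\<^sup>2 * nderiv 1 u t) (at t)"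
      using D[OF assms(2)] by (auto intro!: derivative_eq_intros)
    moreover have "((\<lambda>t. t\<^sup>2 * u t) has_real_derivative t * h t) (at t)"
      unfolding u_def by (rule square_times_linear_dilation_mean_derivative[OF _ assms(2)])
        (rule smooth_on_imp_continuous_on[OF assms(1)])
    ultimately have "2 * t * u t + t\<^sup>2 * nderiv 1 u t = t * h t"
      by (rule DERIV_unique)
    then have "t * (2 * u t + t * nderiv 1 u t) = t * h t"
      by (simp add: power2_eq_square algebra_simps)
    then show ?thesis using False by simp
  qed
  then show ?thesis
    using D[OF assms(2)] by (auto intro!: derivative_eq_intros simp: mult.commute)
qed

section \<open>Realizing a curvature function\<close>

definition plane_vec :: "real \<Rightarrow> real \<Rightarrow> real^2" where
  "plane_vec a b = a *\<^sub>R axis 1 1 + b *\<^sub>R axis 2 1"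

lemma plane_vec_nth [simp]: "plane_vec a b $ 1 = a" "plane_vec a b $ 2 = b"
  by (simp_all add: plane_vec_def axis_def)

lemma bracket_plane_vec [simp]: "bracket (plane_vec a b) (plane_vec c d) = a * d - b * c"
  by (simp add: bracket_def)

lemma plane_vec_has_derivative:
  assumes "(x has_real_derivative x') (at t)" "(y has_real_derivative y') (at t)"
  shows "((\<lambda>t. plane_vec (x t) (y t)) has_vector_derivative plane_vec x' y') (at t)"
  using assms unfolding plane_vec_def has_real_derivative_iff_has_vector_derivative[symmetric]
  by (auto intro!: derivative_eq_intros)

lemma smooth_on_plane_vec:
  "open S \<Longrightarrow> smooth_on S x \<Longrightarrow> smooth_on S y \<Longrightarrow> smooth_on S (\<lambda>t. plane_vec (x t) (y t))"
  unfolding plane_vec_def by (intro smooth_on_add smooth_on_scaleR smooth_on_const)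

lemma nderiv_at_step:
  assumes "open S" "\<And>s. s \<in> S \<Longrightarrow> nderiv n f s = g s"
    "\<And>s. s \<in> S \<Longrightarrow> (g has_vector_derivative g' s) (at s)" "t \<in> S"
  shows "nderiv (Suc n) f t = g' t"
proof -
  have "(nderiv n f has_vector_derivative g' t) (at t)"
    using has_vector_derivative_cong_open[OF assms(1,4), of "nderiv n f" g] assms(2,3,4) by simp
  then show ?thesis by (simp add: nderiv_Suc vector_derivative_at)
qed

text \<open>
  If \<open>[\<gamma>', \<gamma>''] = c t\<close>, then \<open>w\<close> is the constant \<open>c\<close>, and \<open>c = 64/27 = (4/3)\<^sup>3\<close> is the value for which \<open>\<sigma> = 1\<close>.
  Moreover \<open>[\<gamma>', \<gamma>'''']\<close> equals \<open>- [\<gamma>'', \<gamma>''']\<close>, the derivative of the constant \<open>[\<gamma>', \<gamma>''']\<close> being zero.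
\<close>

lemma inflection_with_linear_bracket:
  assumes d: "0 < d" and smooth: "smooth_on {-d<..<d} \<gamma>"
    and W: "\<And>t. t \<in> {-d<..<d} \<Longrightarrow> deriv_bracket \<gamma> 1 2 t = 64/27 * t"
      "\<And>t. t \<in> {-d<..<d} \<Longrightarrow> deriv_bracket \<gamma> 1 3 t = 64/27"
    and t: "t \<in> {-d<..<d}"
  shows "three_quarter_arclength \<gamma> t = t"
    "normalized_affine_curvature \<gamma> t = 27/64 * 9/16 * t * deriv_bracket \<gamma> 2 3 t - 5/16"
proof -
  have 0: "0 \<in> {-d<..<d}" using d by simp
  have "0 < sgn (deriv_bracket \<gamma> 1 3 0) * deriv_bracket \<gamma> 1 3 s" if "s \<in> {-d<..<d}" for s
    unfolding W(2)[OF 0] W(2)[OF that] by simp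
  then interpret inflection_germ \<gamma> d
    using d smooth W(1)[OF 0] by unfold_locales simp_all
  have w: "w s = 64/27" if "s \<in> {-d<..<d}" for s
  proof -
    have "w s = integral {0..1} (\<lambda>v::real. 64/27)"
      unfolding w_def dilation_mean_def
      by (rule integral_cong) (simp add: W(2)[OF scaled_mem_symmetric_interval[OF that]])
    then show ?thesis by simp
  qed
  have \<epsilon>: "\<epsilon> = 1" using W(2)[OF 0] by (simp add: \<epsilon>_def)
  have cuberoot: "(64/27::real) powr (1/3) = 4/3"
  proof -
    have "(64/27::real) powr (1/3) = ((4/3) powr 3) powr (1/3)"
      by (simp add: power3_eq_cube)
    also have "\<dots> = 4/3" unfolding powr_powr by simp
    finally show ?thesis .
  qed
  have \<omega>: "\<omega> s = 4/3" if "s \<in> {-d<..<d}" for s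
    unfolding \<omega>_def w[OF that] \<epsilon> mult_1 by (rule cuberoot)
  have "\<sigma> t = integral {0..1} (\<lambda>v. v powr (1/3) * (4/3))"
    unfolding \<sigma>_def dilation_mean_def
    by (rule integral_cong) (simp add: \<omega>[OF scaled_mem_symmetric_interval[OF t]])
  then have \<sigma>: "\<sigma> t = 1" by (simp add: integral_powr_unit)
  then show "three_quarter_arclength \<gamma> t = t"
    by (simp add: three_quarter_arclength_eq[OF t] \<rho>_def)
  have "((\<lambda>t. 64/27) has_real_derivative
      deriv_bracket \<gamma> 2 3 t + deriv_bracket \<gamma> 1 4 t) (at t)"
    using deriv_bracket_has_derivative[OF smooth t, of 1 3] t W(2)
      has_vector_derivative_cong_open[OF _ t, of "deriv_bracket \<gamma> 1 3" "\<lambda>t. 64/27"]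
    by (simp add: has_real_derivative_iff_has_vector_derivative)
  then have "deriv_bracket \<gamma> 2 3 t + deriv_bracket \<gamma> 1 4 t = 0"
    using DERIV_const DERIV_unique by blast
  then have "deriv_bracket \<gamma> 1 4 t = - deriv_bracket \<gamma> 2 3 t" by simp
  then show "normalized_affine_curvature \<gamma> t = 27/64 * 9/16 * t * deriv_bracket \<gamma> 2 3 t - 5/16"
    by (simp add: normalized_curvature_eq[OF t] F_def N_def \<sigma> \<omega>[OF t] W[OF t] field_simps)
qed

text \<open>
  The velocity has the components \<open>y0 = 1 + p(0) t + t\<^sup>2 u0\<close> and \<open>y1 = t\<^sup>2 u1\<close>, two solutions of
  \<open>t y'' - y' + p y = 0\<close> with exponents \<open>0\<close> and \<open>2\<close>. Their Wronskian is \<open>t k\<close> with \<open>k\<close> constant.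
\<close>

lemma curvature_function_realized:
  assumes f: "smooth_at 0 f" "f 0 = - (5/16)" and rel: "32 * (nderiv 1 f 0)\<^sup>2 + 9 * nderiv 2 f 0 = 0"
  shows "\<exists>(I :: real set) (\<gamma> :: real \<Rightarrow> real^2).
               0 \<in> I \<and> regular_curve I \<gamma> \<and> generic_inflection_point \<gamma> 0 \<and>
               (\<forall>t\<in>I. three_quarter_arclength \<gamma> t = t) \<and>
               (\<forall>t\<in>I. normalized_affine_curvature \<gamma> t = f t)"
proof -
  obtain S where S: "open S" "0 \<in> S" "smooth_on S f"
    using f(1) by (auto simp: smooth_at_def)
  then obtain d where d: "0 < d" "{-d<..<d} \<subseteq> S"
    using open_contains_ball[of S] by (auto simp: ball_eq_greaterThanLessThan)
  have sf: "smooth_on {-d<..<d} f"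
    by (rule smooth_on_subset[OF S(3) d(2)])
  have sf1: "smooth_on {-d<..<d} (nderiv 1 f)"
    by (rule smooth_on_nderiv[OF _ sf]) simp
  \<comment> \<open>The solution of \<open>t p = 16/9 (f + 5/16)\<close>.\<close>
  define p where "p t = 16/9 * dilation_mean (\<lambda>_. 1) (nderiv 1 f) t" for t
  have sp: "smooth_on {-d<..<d} p"
    unfolding p_def by (intro smooth_on_mult smooth_on_const smooth_on_dilation_mean sf1) auto
  have tp: "t * p t = 16/9 * (f t + 5/16)" if "t \<in> {-d<..<d}" for t
    using hadamard_factor[OF sf that] f(2) by (simp add: p_def)
  have 0: "0 \<in> {-d<..<d}" using d by simp
  have "nderiv 1 (nderiv 1 f) = nderiv 2 f"
    by (simp add: nderiv_def numeral_2_eq_2 One_nat_def)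
  then have "has_2jet (nderiv 1 f) (nderiv 1 f 0) (nderiv 2 f 0) (nderiv 2 (nderiv 1 f) 0)"
    using smooth_on_has_2jet[OF _ 0 sf1] by simp
  from has_2jet_cmult[OF has_2jet_dilation_mean_one[OF d(1) sf1 this], of "16/9"]
  have "has_2jet p (16/9 * nderiv 1 f 0) (16/9 * (nderiv 2 f 0 / 2)) (16/9 * (nderiv 2 (nderiv 1 f) 0 / 3))"
    unfolding p_def[abs_def] .
  from has_2jet_unique[OF smooth_on_has_2jet[OF _ 0 sp] this]
  have p01: "p 0 = 16/9 * nderiv 1 f 0" "nderiv 1 p 0 = 16/9 * (nderiv 2 f 0 / 2)"
    by simp_all
  \<comment> \<open>Inserting \<open>1 + p(0) t\<close> into \<open>t y'' - y' + p y\<close> leaves \<open>t m(t)\<close>, and \<open>m(0) = p'(0) + p(0)\<^sup>2\<close> is the obstruction.\<close>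
  define m where "m t = dilation_mean (\<lambda>_. 1) (nderiv 1 p) t + p 0 * p t" for t
  have sm: "smooth_on {-d<..<d} m"
    unfolding m_def
    by (intro smooth_on_add smooth_on_mult smooth_on_const smooth_on_dilation_mean sp smooth_on_nderiv) auto
  have m0: "m 0 = 0"
    using rel by (simp add: m_def dilation_mean_0 p01 power2_eq_square field_simps)
  \<comment> \<open>As \<open>m(0) = 0\<close>, the remainder is \<open>t\<^sup>2 r\<close> with \<open>r\<close> smooth, which the correction \<open>t\<^sup>2 u0\<close> can compensate.\<close>
  define r where "r = dilation_mean (\<lambda>_. 1) (nderiv 1 m)"
  have sr: "smooth_on {-d<..<d} r"
    unfolding r_def by (intro smooth_on_dilation_mean smooth_on_nderiv sm) auto
  have r: "t\<^sup>2 * r t = p t * (1 + p 0 * t) - p 0" if "t \<in> {-d<..<d}" for t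
  proof -
    have "t * r t = m t"
      using hadamard_factor[OF sm that] m0 by (simp add: r_def)
    moreover have "t * dilation_mean (\<lambda>_. 1) (nderiv 1 p) t = p t - p 0"
      by (rule hadamard_factor[OF sp that])
    ultimately show ?thesis by (simp add: m_def power2_eq_square algebra_simps)
  qed
  obtain e0 V0 where e0: "0 < e0" "e0 < d" "smooth_on {-e0<..<e0} V0" "V0 0 = 0"
    and DV0: "\<forall>t\<in>{-e0<..<e0}. (V0 has_real_derivative
      - (p t * dilation_mean (\<lambda>v. v) V0 t + r t)) (at t)"
    by (rule singular_equation_solution[OF d(1) sp sr])
  have s0: "smooth_on {-d<..<d} (\<lambda>_. 0::real)" by (rule smooth_on_const) simp
  \<comment> \<open>The initial value \<open>64/27\<close> normalizes the Wronskian.\<close>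
  obtain e1 V1 where e1: "0 < e1" "e1 < d" "smooth_on {-e1<..<e1} V1" "V1 0 = 64/27"
    and DV1: "\<forall>t\<in>{-e1<..<e1}. (V1 has_real_derivative
      - (p t * dilation_mean (\<lambda>v. v) V1 t + 0)) (at t)"
    by (rule singular_equation_solution[OF d(1) sp s0])
  define e where "e = min e0 e1"
  define E where "E = {-e<..<e}"
  have e: "0 < e" "E \<subseteq> {-e0<..<e0}" "E \<subseteq> {-e1<..<e1}" "E \<subseteq> {-d<..<d}" "open E"
    using e0(1,2) e1(1,2) by (auto simp: E_def e_def)
  have zE: "0 \<in> E" using e(1) by (simp add: E_def)
  define u0 u1 where "u0 = dilation_mean (\<lambda>v. v) V0" and "u1 = dilation_mean (\<lambda>v. v) V1"
  have sV: "smooth_on E V0" "smooth_on E V1"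
    using smooth_on_subset e0(3) e1(3) e by blast+
  have su: "smooth_on E u0" "smooth_on E u1"
    using sV unfolding u0_def u1_def E_def by (intro smooth_on_dilation_mean continuous_intros; simp)+
  have DV: "(V0 has_real_derivative - (p t * u0 t + r t)) (at t)"
      "(V1 has_real_derivative - (p t * u1 t)) (at t)" if "t \<in> E" for t
    using DV0 DV1 that e by (auto simp: u0_def u1_def)
  define y0 y1 where "y0 t = 1 + p 0 * t + t\<^sup>2 * u0 t" and "y1 t = t\<^sup>2 * u1 t" for t
  have Dq: "((\<lambda>t. t\<^sup>2 * u0 t) has_real_derivative t * V0 t) (at t)"
      "((\<lambda>t. t\<^sup>2 * u1 t) has_real_derivative t * V1 t) (at t)" if "t \<in> E" for t
    using square_times_linear_dilation_mean_derivative[of e V0 t]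
      square_times_linear_dilation_mean_derivative[of e V1 t]
      sV[THEN smooth_on_imp_continuous_on] that
    by (simp_all add: u0_def u1_def E_def)
  have Dy: "(y0 has_real_derivative p 0 + t * V0 t) (at t)" "(y1 has_real_derivative t * V1 t) (at t)"
    if "t \<in> E" for t
  proof -
    have "((\<lambda>t. 1 + p 0 * t) has_real_derivative p 0) (at t)"
      by (auto intro!: derivative_eq_intros)
    then show "(y0 has_real_derivative p 0 + t * V0 t) (at t)"
      unfolding y0_def[abs_def] by (rule DERIV_add[OF _ Dq(1)[OF that]])
    show "(y1 has_real_derivative t * V1 t) (at t)"
      unfolding y1_def[abs_def] by (rule Dq(2)[OF that])
  qed
  have Dy': "((\<lambda>t. p 0 + t * V0 t) has_real_derivative V0 t - t * (p t * u0 t + r t)) (at t)"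
      "((\<lambda>t. t * V1 t) has_real_derivative V1 t - t * (p t * u1 t)) (at t)" if "t \<in> E" for t
    using DV[OF that] by (auto intro!: derivative_eq_intros simp: algebra_simps)
  have sy: "smooth_on E y0" "smooth_on E y1"
    unfolding y0_def[abs_def] y1_def[abs_def]
    by (intro smooth_on_add smooth_on_mult smooth_on_power smooth_on_const smooth_on_ident su e)+
  define k where "k t = y0 t * V1 t - t * u1 t * (p 0 + t * V0 t)" for t
  have Dk: "(k has_real_derivative 0) (at t)" if t: "t \<in> E" for t
  proof -
    have "((\<lambda>t. t * u1 t) has_real_derivative V1 t - u1 t) (at t)"
      using linear_dilation_mean_euler[of e V1 t] sV(2) t by (simp add: u1_def E_def)
    then have "(k has_real_derivative (p 0 + t * V0 t) * V1 t + y0 t * (- (p t * u1 t))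
        - ((V1 t - u1 t) * (p 0 + t * V0 t) + t * u1 t * (V0 t - t * (p t * u0 t + r t)))) (at t)"
      unfolding k_def[abs_def]
      by (rule DERIV_diff[OF DERIV_mult[OF Dy(1)[OF t] DV(2)[OF t]] DERIV_mult[OF _ Dy'(1)[OF t]], THEN DERIV_cong])
        (simp add: algebra_simps)
    moreover have "t\<^sup>2 * r t = p t * (1 + p 0 * t) - p 0"
      using r[of t] e(4) t by auto
    then have "(p 0 + t * V0 t) * V1 t + y0 t * (- (p t * u1 t))
        - ((V1 t - u1 t) * (p 0 + t * V0 t) + t * u1 t * (V0 t - t * (p t * u0 t + r t))) = 0"
      unfolding y0_def by algebra
    ultimately show ?thesis by simp
  qed
  have k: "k t = 64/27" if "t \<in> E" for t
  proof -
    have "\<exists>c. \<forall>t\<in>E. k t = c"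
      using Dk by (intro has_field_derivative_zero_constant) (auto simp: E_def has_field_derivative_at_within)
    then have "k t = k 0" using that zE by metis
    then show ?thesis by (simp add: k_def y0_def e1(4))
  qed
  define \<gamma> where "\<gamma> t = plane_vec (t * dilation_mean (\<lambda>_. 1) y0 t) (t * dilation_mean (\<lambda>_. 1) y1 t)" for t
  have s\<gamma>: "smooth_on E \<gamma>"
    unfolding \<gamma>_def[abs_def]
    by (intro smooth_on_plane_vec smooth_on_mult smooth_on_ident e)
      (use sy in \<open>auto simp: E_def intro!: smooth_on_dilation_mean\<close>)
  have n1: "nderiv 1 \<gamma> t = plane_vec (y0 t) (y1 t)" if "t \<in> E" for t
    unfolding One_nat_def
  proof (rule nderiv_at_step[OF e(5) _ _ that])
    show "(\<gamma> has_vector_derivative plane_vec (y0 s) (y1 s)) (at s)" if "s \<in> E" for s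
      unfolding \<gamma>_def[abs_def]
      using sy[THEN smooth_on_imp_continuous_on] that
      by (intro plane_vec_has_derivative has_derivative_antiderivative[of e]) (auto simp: E_def)
  qed (simp add: nderiv_0)
  have n2: "nderiv 2 \<gamma> t = plane_vec (p 0 + t * V0 t) (t * V1 t)" if "t \<in> E" for t
    unfolding Suc_1[symmetric]
    by (rule nderiv_at_step[OF e(5) n1 _ that])
      (use plane_vec_has_derivative[OF Dy] in simp_all)
  have n3: "nderiv 3 \<gamma> t = plane_vec (V0 t - t * (p t * u0 t + r t)) (V1 t - t * (p t * u1 t))" if "t \<in> E" for t
    unfolding numeral_3_eq_3 numeral_2_eq_2[symmetric]
    by (rule nderiv_at_step[OF e(5) n2 _ that])
      (use plane_vec_has_derivative[OF Dy'] in simp_all)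
  have W: "deriv_bracket \<gamma> 1 2 t = 64/27 * t" if "t \<in> E" for t
  proof -
    have "deriv_bracket \<gamma> 1 2 t = t * k t"
      by (simp add: n1[OF that] n2[OF that] k_def y1_def algebra_simps power2_eq_square)
    then show ?thesis using k[OF that] by simp
  qed
  have W3: "deriv_bracket \<gamma> 1 3 t = 64/27" if "t \<in> E" for t
  proof -
    have "((\<lambda>t. 64/27 * t) has_real_derivative deriv_bracket \<gamma> 1 3 t) (at t)"
      using deriv_bracket_has_derivative[OF s\<gamma> that, of 1 2] W that
        has_vector_derivative_cong_open[OF e(5) that, of "deriv_bracket \<gamma> 1 2" "\<lambda>t. 64/27 * t"]
      by (simp add: has_real_derivative_iff_has_vector_derivative)
    moreover have "((\<lambda>t. 64/27 * t) has_real_derivative 64/27) (at t)"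
      by (auto intro!: derivative_eq_intros)
    ultimately show ?thesis by (rule DERIV_unique)
  qed
  \<comment> \<open>From \<open>T'' = (T' - p T) / t\<close> one expects \<open>[T', T''] = p [T, T'] / t = p k\<close>; the check avoids the division.\<close>
  have q: "deriv_bracket \<gamma> 2 3 t = 64/27 * p t" if "t \<in> E" for t
  proof -
    have "deriv_bracket \<gamma> 2 3 t - p t * k t = V1 t * (t\<^sup>2 * r t - (p t * (1 + p 0 * t) - p 0))"
      by (simp add: n2[OF that] n3[OF that] k_def y0_def algebra_simps power2_eq_square)
    then show ?thesis using r[of t] k[OF that] e(4) that by auto
  qed
  have nz: "nderiv 1 \<gamma> t \<noteq> 0" if "t \<in> E" for t
  proof
    assume "nderiv 1 \<gamma> t = 0"
    then have "deriv_bracket \<gamma> 1 3 t = 0" by (simp add: bracket_def)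
    then show False using W3[OF that] by simp
  qed
  have lin: "three_quarter_arclength \<gamma> t = t"
    "normalized_affine_curvature \<gamma> t = 27/64 * 9/16 * t * deriv_bracket \<gamma> 2 3 t - 5/16"
    if "t \<in> E" for t
    using inflection_with_linear_bracket[OF e(1) s\<gamma>[unfolded E_def] W[unfolded E_def] W3[unfolded E_def]
        that[unfolded E_def]] by simp_all
  have "normalized_affine_curvature \<gamma> t = f t" if "t \<in> E" for t
  proof -
    have "27/64 * 9/16 * t * (64/27 * p t) - 5/16 = 9/16 * (t * p t) - 5/16" by simp
    also have "\<dots> = f t" using tp[of t] e(4) that by auto
    finally show ?thesis by (simp add: lin(2)[OF that] q[OF that])
  qed
  moreover have "regular_curve E \<gamma>"
    using e(5) s\<gamma> nz by (auto simp: regular_curve_def E_def is_interval_1)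
  moreover have "generic_inflection_point \<gamma> 0"
    using W[OF zE] W3[OF zE] by (simp add: generic_inflection_point_def inflection_point_def)
  ultimately show ?thesis
    using zE lin(1) by blast
qed

section \<open>The affine curvature at inflection points\<close>

theorem theorem4p4:
  shows "(\<forall>(I :: real set) (\<gamma> :: real \<Rightarrow> real^2).
            0 \<in> I \<and> regular_curve I \<gamma> \<and> generic_inflection_point \<gamma> 0 \<longrightarrow>
            (let f = normalized_affine_curvature \<gamma>; \<tau> = three_quarter_arclength \<gamma> in
               local_coordinate_at 0 \<tau> \<and>
               smooth_at 0 f \<and>
               (\<exists>g. smooth_at 0 g \<and> (\<forall>\<^sub>F t in nhds 0. f t = g (\<tau> t)) \<and>
                    32 * (nderiv 1 g 0)\<^sup>2 + 9 * nderiv 2 g 0 = 0) \<and>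
               - (9/7) * ((bracket (nderiv 1 \<gamma> 0) (nderiv 4 \<gamma> 0)
                            + bracket (nderiv 2 \<gamma> 0) (nderiv 3 \<gamma> 0))
                          / bracket (nderiv 1 \<gamma> 0) (nderiv 3 \<gamma> 0)) * nderiv 1 f 0
                 + 32 * (nderiv 1 f 0)\<^sup>2 + 9 * nderiv 2 f 0 = 0 \<and>
               ((\<lambda>t. (affine_arclength \<gamma> t)\<^sup>2 * affine_curvature \<gamma> t) \<longlongrightarrow> - (5/16)) (at 0) \<and>
               f 0 = - (5/16) \<and>
               ((\<lambda>t. ((affine_arclength \<gamma> t)\<^sup>2 * affine_curvature \<gamma> t + 5/16) / \<tau> t)
                  \<longlongrightarrow> - (3 * root 4 3 / (28 * sqrt 2)) * affine_inflectional_curvature \<gamma> 0) (at 0) \<and>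
               ((\<forall>\<^sub>F t in nhds 0. \<tau> t = t) \<longrightarrow>
                  32 * (nderiv 1 f 0)\<^sup>2 + 9 * nderiv 2 f 0 = 0)))
       \<and>
         (\<forall>f :: real \<Rightarrow> real.
            smooth_at 0 f \<and> f 0 = - (5/16) \<and> 32 * (nderiv 1 f 0)\<^sup>2 + 9 * nderiv 2 f 0 = 0 \<longrightarrow>
            (\<exists>(I :: real set) (\<gamma> :: real \<Rightarrow> real^2).
               0 \<in> I \<and> regular_curve I \<gamma> \<and> generic_inflection_point \<gamma> 0 \<and>
               (\<forall>t\<in>I. three_quarter_arclength \<gamma> t = t) \<and>
               (\<forall>t\<in>I. normalized_affine_curvature \<gamma> t = f t)))"
  by (rule conjI; intro allI impI; elim conjE;
      rule generic_inflection_curvature curvature_function_realized; assumption)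

end
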